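(* Consider the database model with side information available only at the user and a single utility constraint ($L=1$). Then $$\Gamma(D)=\sup_{p(\mathbf{x}_r,\mathbf{x}_h,z)p(u|\mathbf{x}_r,\mathbf{x}_h)\in\mathcal{P}(D)} H(\mathbf{X}_h\mid U,Z),$$ $$R(D,E)=\inf_{p(\mathbf{x}_r,\mathbf{x}_h,z)p(u|\mathbf{x}_r,\mathbf{x}_h)\in\mathcal{P}(D,E)} \big[I(\mathbf{X}_h\mathbf{X}_r;U)-I(Z;U)\big],$$ $$\mathcal{R}_{D-E}=\{(D,E):D\ge0,\ 0\le E\le\Gamma(D)\},$$ $$\mathcal{R}=\{(R,D,E):D\ge0,\ 0\le E\le\Gamma(D),\ R\ge R(D,E)\}.$$ Here $\mathcal{P}(D,E)$ is the set of all joint distributions of the form $p(\mathbf{x}_r,\mathbf{x}_h,z)\,p(u|\mathbf{x}_r,\mathbf{x}_h)$, where $p(\mathbf{x}_r,\mathbf{x}_h,z)$ is the given source distribution and $U$ is an auxiliary random variable on a finite alphabet (so that $U-(\mathbf{X}_r,\mathbf{X}_h)-Z$ is a Markov chain), for which there is a reconstruction function $\phi$ with $\mathbb{E}[d(\mathbf{X}_r,\phi(U,Z))]\le D$ and $H(\mathbf{X}_h\mid U,Z)\ge E$. Also $\mathcal{P}(D)=\bigcup_{H(\mathbf{X}_h|\mathbf{X}_r Z)\le E\le H(\mathbf{X}_h|Z)}\mathcal{P}(D,E)$.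
   Context: Database model: there are $K$ attributes, with $X_k$ taking values in a finite alphabet $\mathcal{X}_k$, $\mathbf{X}=(X_1,\dots,X_K)$ with a known joint pmf. Let $\mathcal{K}_r,\mathcal{K}_h\subseteq\{1,\dots,K\}$ with union $\{1,\dots,K\}$, $\mathbf{X}_r=(X_k)_{k\in\mathcal{K}_r}$ (public), and $\mathbf{X}_h=(X_k)_{k\in\mathcal{K}_h}$ (private). The triples $(\mathbf{X}_{r,i},\mathbf{X}_{h,i},Z_i)$, $i=1,\dots,n$, are i.i.d. with a given pmf $p(\mathbf{x}_r,\mathbf{x}_h,z)$, where $Z^n$ is side information available only to the user (the decoder), not to the encoder. A code of length $n$ consists of an encoder $F_E$ mapping $(\mathbf{X}_r^n,\mathbf{X}_h^n)$ to $W\in\{1,\dots,M\}$ and a decoder $F_D$ mapping $(W,Z^n)$ to $\hat{\mathbf{X}}_r^n$. The utility constraint is $\mathbb{E}[\frac1n\sum_{i=1}^n d(\mathbf{X}_{r,i},\hat{\mathbf{X}}_{r,i})]\le D+\epsilon$ for a given per-letter distortion $d$. The privacy constraint is $\frac1n H(\mathbf{X}_h^n\mid W,Z^n)\ge E-\epsilon$. The rate constraint is $M\le 2^{n(R+\epsilon)}$. $\mathcal{R}$ is the set of $(R,D,E)$ such that for every $\epsilon>0$ there exists a code, for some (sufficiently large) $n$, satisfying all three constraints; $\mathcal{R}_{D-E}$ is its projection onto the $(D,E)$ coordinates. $\Gamma(D)$ denotes the boundary of $\mathcal{R}_{D-E}$, namely the maximal achievable equivocation at distortion $D$. $R(D,E)$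 denotes the minimal rate $R$ with $(R,D,E)\in\mathcal{R}$. *)

theory Defs
  imports "HOL-Probability.Probability"
begin

definition ent :: "'a pmf \<Rightarrow> real" where
  "ent p = - (\<Sum>x\<in>set_pmf p. pmf p x * log 2 (pmf p x))"

definition cent :: "'w pmf \<Rightarrow> ('w \<Rightarrow> 'a) \<Rightarrow> ('w \<Rightarrow> 'b) \<Rightarrow> real" where
  "cent p X Y = ent (map_pmf (\<lambda>w. (X w, Y w)) p) - ent (map_pmf Y p)"

definition minf :: "'w pmf \<Rightarrow> ('w \<Rightarrow> 'a) \<Rightarrow> ('w \<Rightarrow> 'b) \<Rightarrow> real" where
  "minf p X Y = ent (map_pmf X p) + ent (map_pmf Y p) - ent (map_pmf (\<lambda>w. (X w, Y w)) p)"

text \<open>Joint distribution p(x_r,x_h,z) p(u|x_r,x_h); the auxiliary alphabet is a finite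
  subset of nat (every finite alphabet embeds in nat).\<close>
definition joint ::
  "('r \<times> 'h \<times> 'z) pmf \<Rightarrow> ('r \<times> 'h \<Rightarrow> nat pmf) \<Rightarrow> ('r \<times> 'h \<times> 'z \<times> nat) pmf" where
  "joint src Q = src \<bind> (\<lambda>(xr, xh, z). map_pmf (\<lambda>u. (xr, xh, z, u)) (Q (xr, xh)))"

definition aux_ok :: "('r \<times> 'h \<Rightarrow> nat pmf) \<Rightarrow> bool" where
  "aux_ok Q \<longleftrightarrow> (\<exists>S. finite S \<and> (\<forall>a. set_pmf (Q a) \<subseteq> S))"

definition PDE ::
  "('r \<times> 'h \<times> 'z) pmf \<Rightarrow> ('r \<Rightarrow> 'r \<Rightarrow> real) \<Rightarrow> real \<Rightarrow> real \<Rightarrow> ('r \<times> 'h \<Rightarrow> nat pmf) set" where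
  "PDE src d D E = {Q. aux_ok Q \<and>
      (\<exists>\<phi> :: nat \<Rightarrow> 'z \<Rightarrow> 'r.
         measure_pmf.expectation (joint src Q) (\<lambda>(xr, xh, z, u). d xr (\<phi> u z)) \<le> D) \<and>
      cent (joint src Q) (\<lambda>(xr, xh, z, u). xh) (\<lambda>(xr, xh, z, u). (u, z)) \<ge> E}"

definition PD ::
  "('r \<times> 'h \<times> 'z) pmf \<Rightarrow> ('r \<Rightarrow> 'r \<Rightarrow> real) \<Rightarrow> real \<Rightarrow> ('r \<times> 'h \<Rightarrow> nat pmf) set" where
  "PD src d D = (\<Union>E \<in> {cent src (\<lambda>(xr, xh, z). xh) (\<lambda>(xr, xh, z). (xr, z)) ..
                          cent src (\<lambda>(xr, xh, z). xh) (\<lambda>(xr, xh, z). z)}. PDE src d D E)"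

text \<open>The information-theoretic expressions (sup over empty set = -inf, inf over empty set = +inf).\<close>
definition Gamma_info :: "('r \<times> 'h \<times> 'z) pmf \<Rightarrow> ('r \<Rightarrow> 'r \<Rightarrow> real) \<Rightarrow> real \<Rightarrow> ereal" where
  "Gamma_info src d D = (SUP Q \<in> PD src d D.
      ereal (cent (joint src Q) (\<lambda>(xr, xh, z, u). xh) (\<lambda>(xr, xh, z, u). (u, z))))"

definition Rate_info :: "('r \<times> 'h \<times> 'z) pmf \<Rightarrow> ('r \<Rightarrow> 'r \<Rightarrow> real) \<Rightarrow> real \<Rightarrow> real \<Rightarrow> ereal" where
  "Rate_info src d D E = (INF Q \<in> PDE src d D E.
      ereal (minf (joint src Q) (\<lambda>(xr, xh, z, u). (xh, xr)) (\<lambda>(xr, xh, z, u). u)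
           - minf (joint src Q) (\<lambda>(xr, xh, z, u). z) (\<lambda>(xr, xh, z, u). u)))"

definition src_n :: "('r \<times> 'h \<times> 'z) pmf \<Rightarrow> nat \<Rightarrow> (nat \<Rightarrow> 'r \<times> 'h \<times> 'z) pmf" where
  "src_n src n = Pi_pmf {..<n} undefined (\<lambda>_. src)"

definition code_ok ::
  "('r \<times> 'h \<times> 'z) pmf \<Rightarrow> ('r \<Rightarrow> 'r \<Rightarrow> real) \<Rightarrow> real \<Rightarrow> real \<Rightarrow> real \<Rightarrow> real \<Rightarrow> nat \<Rightarrow> nat
    \<Rightarrow> ((nat \<Rightarrow> 'r) \<Rightarrow> (nat \<Rightarrow> 'h) \<Rightarrow> nat) \<Rightarrow> (nat \<Rightarrow> (nat \<Rightarrow> 'z) \<Rightarrow> (nat \<Rightarrow> 'r)) \<Rightarrow> bool" where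
  "code_ok src d R D E \<epsilon> n M FE FD \<longleftrightarrow>
     (let P = src_n src n;
          Xr = (\<lambda>x i. fst (x i));
          Xh = (\<lambda>x i. fst (snd (x i)));
          Zs = (\<lambda>x i. snd (snd (x i)));
          W = (\<lambda>x. FE (Xr x) (Xh x))
      in (\<forall>xr xh. FE xr xh \<in> {1..M}) \<and>
         real M \<le> 2 powr (real n * (R + \<epsilon>)) \<and>
         measure_pmf.expectation P
           (\<lambda>x. (1 / real n) * (\<Sum>i<n. d (Xr x i) (FD (W x) (Zs x) i))) \<le> D + \<epsilon> \<and>
         (1 / real n) * cent P Xh (\<lambda>x. (W x, Zs x)) \<ge> E - \<epsilon>)"

definition region :: "('r \<times> 'h \<times> 'z) pmf \<Rightarrow> ('r \<Rightarrow> 'r \<Rightarrow> real) \<Rightarrow> (real \<times> real \<times> real) set" where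
  "region src d = {(R, D, E). R \<ge> 0 \<and> D \<ge> 0 \<and> E \<ge> 0 \<and>
      (\<forall>\<epsilon>>0. \<exists>n>0. \<exists>M>0. \<exists>FE FD. code_ok src d R D E \<epsilon> n M FE FD)}"

definition region_DE :: "('r \<times> 'h \<times> 'z) pmf \<Rightarrow> ('r \<Rightarrow> 'r \<Rightarrow> real) \<Rightarrow> (real \<times> real) set" where
  "region_DE src d = (\<lambda>(R, D, E). (D, E)) ` region src d"

definition Gamma_op :: "('r \<times> 'h \<times> 'z) pmf \<Rightarrow> ('r \<Rightarrow> 'r \<Rightarrow> real) \<Rightarrow> real \<Rightarrow> ereal" where
  "Gamma_op src d D = Sup {ereal E | E. (D, E) \<in> region_DE src d}"

definition Rate_op :: "('r \<times> 'h \<times> 'z) pmf \<Rightarrow> ('r \<Rightarrow> 'r \<Rightarrow> real) \<Rightarrow> real \<Rightarrow> real \<Rightarrow> ereal" where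
  "Rate_op src d D E = Inf {ereal R | R. (R, D, E) \<in> region src d}"

end

(* Converse: with W the message and Z' the side information at the other positions, U_i = (W, Z')
   is a valid auxiliary variable at position i, and subadditivity of conditional entropy bounds
   equivocation and rate by averages of single-letter quantities.  Those are homogeneous functions
   of the unnormalised posteriors p(x, u), so the achievable points form a slice of the convex hull
   of a compact set.  Compactness of this hull replaces a cardinality bound on U and lets epsilon
   tend to 0.

   Achievability: attach independent Exp(1) clocks T(u,m) to all pairs of a word u and a bin m.  The
   encoder sends the bin of the pair minimising T(u,m) / p(u|x), the decoder minimises T(u,m) / p(u|z)
   over the received bin m.  Both name the same word with high probability once the number of bins
   slightly exceeds 2^(n I(X;U|Z)), and the word has law p(u|x).  A realisation of the clocks is then
   fixed.  The equivocation is H(X_h|W,Z) >= H(X|Z) - log M - H(X_r|X_h,W,Z), and the last term is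
   estimated by cross entropy against the conditional law of X_r given X_h, Z and the decoded word. *)

theory Submission
  imports Defs "HOL-Real_Asymp.Real_Asymp"
begin

section \<open>One-shot Wyner-Ziv coding by exponential races\<close>

text \<open>The privacy constraint concerns all n letters jointly and is not an average of
  per-letter costs. It is deduced from two quantities of a fixed code: the number of messages and
  the probability that the decoded word is typical with the source. Hence one favourable event per
  code suffices, and fixing the clocks needs only one expectation. Nothing is lost in the limit,
  because with X = (X_r, X_h) one has H(X|Z) - I(X;U|Z) - H(X_r|X_h,U,Z) = H(X_h|U,Z); one test
  channel serves rate, distortion and equivocation together.

  In the converse, codes meet the constraints only up to epsilon, whereas P(D,E) imposes them
  exactly, so a limit of approximating points must itself come from a test channel. The alphabets of
  the U_i grow with n. The limit is therefore taken not among channels but among points (source law,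
  distortion, equivocation, H(X|U,Z)), whose dimension is fixed. The source law is carried along so
  that a point of the hull can be turned back into a channel.\<close>

definition std_exponential :: "real measure" where
  "std_exponential = density lborel (exponential_density 1)"

lemma prob_space_std_exponential: "prob_space std_exponential"
  unfolding std_exponential_def by (rule prob_space_exponential_density) simp

lemma sets_std_exponential [measurable_cong, simp]: "sets std_exponential = sets borel"
  by (simp add: std_exponential_def)

lemma space_std_exponential [simp]: "space std_exponential = UNIV"
  by (simp add: std_exponential_def)

lemma emeasure_std_exponential_greaterThan:
  assumes "0 \<le> t"
  shows "emeasure std_exponential {t<..} = ennreal (exp (- t))"
proof -
  interpret E: prob_space std_exponential by (rule prob_space_std_exponential)
  have "distributed std_exponential lborel (\<lambda>x. x) (exponential_density 1)"
    by (auto simp: distributed_def std_exponential_def distr_id2 exponential_density_def)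
  from E.exponential_distributedD_gt[OF this assms] show ?thesis
    by (simp add: E.emeasure_eq_measure greaterThan_def)
qed

lemma AE_std_exponential_nonneg: "AE y in std_exponential. 0 \<le> y"
  unfolding std_exponential_def by (subst AE_density) (auto simp: exponential_density_def)

text \<open>The factor exp (- c y) tilts the Exp(1) density into the Exp(1 + c) density times 1 / (1
  + c).\<close>

lemma nn_integral_std_exponential_exp:
  assumes "0 \<le> c"
  shows "(\<integral>\<^sup>+y. ennreal (exp (- (c * y))) \<partial>std_exponential) = ennreal (1 / (1 + c))"
proof -
  interpret D: prob_space "density lborel (exponential_density (1 + c))"
    using assms by (intro prob_space_exponential_density) simp
  have "(\<integral>\<^sup>+y. ennreal (exp (- (c * y))) \<partial>std_exponential)
      = (\<integral>\<^sup>+y. ennreal (exponential_density 1 y) * ennreal (exp (- (c * y))) \<partial>lborel)"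
    unfolding std_exponential_def by (subst nn_integral_density) auto
  also have "\<dots> = (\<integral>\<^sup>+y. ennreal (1 / (1 + c)) * ennreal (exponential_density (1 + c) y) \<partial>lborel)"
    using assms
    by (intro nn_integral_cong)
       (auto simp: exponential_density_def ennreal_mult[symmetric] exp_add[symmetric] divide_simps
          algebra_simps)
  also have "\<dots> = ennreal (1 / (1 + c)) * emeasure (density lborel (exponential_density (1 + c))) UNIV"
    by (simp add: nn_integral_cmult emeasure_density)
  also have "\<dots> = ennreal (1 / (1 + c))"
    using D.emeasure_space_1 by simp
  finally show ?thesis .
qed

text \<open>Given \<open>T a\<close> = y, the other clocks independently exceed
  \<open>c j * y\<close> with probability exp (- c j y). The product is a single exponential in y,
  and its mean under Exp(1) is the Laplace transform above.\<close>

lemma exponential_race: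
  assumes I: "finite I" "a \<in> I" and c: "\<And>j. j \<in> I \<Longrightarrow> 0 \<le> c j"
  shows "emeasure (PiM I (\<lambda>_. std_exponential)) {T \<in> space (PiM I (\<lambda>_. std_exponential)).
            0 \<le> T a \<and> (\<forall>j\<in>I - {a}. c j * T a < T j)}
       = ennreal (1 / (1 + (\<Sum>j\<in>I - {a}. c j)))" (is "emeasure ?M ?A = _")
proof -
  interpret E: prob_space std_exponential by (rule prob_space_std_exponential)
  interpret P: product_sigma_finite "\<lambda>_. std_exponential" ..
  define K where "K = I - {a}"
  have K: "finite K" "a \<notin> K" "I = insert a K" using I by (auto simp: K_def)
  have [measurable]: "?A \<in> sets ?M"
    using I by (auto intro!: sets.sets_Collect_finite_All' sets.sets_Collect_conj)
  have meas: "(\<lambda>T. indicator ?A T :: ennreal) \<in> borel_measurable (PiM (insert a K) (\<lambda>_. std_exponential))"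
    unfolding K(3)[symmetric] by measurable
  have "emeasure ?M ?A = (\<integral>\<^sup>+T. indicator ?A T \<partial>(PiM (insert a K) (\<lambda>_. std_exponential)))"
    unfolding K(3)[symmetric] by simp
  also have "\<dots> = (\<integral>\<^sup>+ y. (\<integral>\<^sup>+ x. indicator ?A (x(a := y)) \<partial>PiM K (\<lambda>_. std_exponential)) \<partial>std_exponential)"
    by (rule P.product_nn_integral_insert_rev[OF K(1,2) meas])
  also have "\<dots> = (\<integral>\<^sup>+ y. ennreal (exp (- ((\<Sum>j\<in>K. c j) * y))) \<partial>std_exponential)"
  proof (rule nn_integral_cong_AE, rule AE_mp[OF AE_std_exponential_nonneg], rule AE_I2, rule impI)
    fix y :: real assume y: "0 \<le> y"
    have "(\<integral>\<^sup>+ x. indicator ?A (x(a := y)) \<partial>PiM K (\<lambda>_. std_exponential))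
        = (\<integral>\<^sup>+ x. indicator (PiE K (\<lambda>j. {c j * y<..})) x \<partial>PiM K (\<lambda>_. std_exponential))"
    proof (rule nn_integral_cong)
      fix x :: "'a \<Rightarrow> real" assume "x \<in> space (PiM K (\<lambda>_. std_exponential))"
      then have ext: "x \<in> extensional K" by (simp add: space_PiM PiE_def)
      then have "x(a := y) \<in> extensional I" using I(2) by (auto simp: extensional_def K_def)
      then have "x(a := y) \<in> ?A \<longleftrightarrow> x \<in> PiE K (\<lambda>j. {c j * y<..})"
        using ext y K(2) unfolding K_def[symmetric] by (auto simp: space_PiM PiE_def)
      then show "indicator ?A (x(a := y)) = (indicator (PiE K (\<lambda>j. {c j * y<..})) x :: ennreal)"
        by (simp add: indicator_def)
    qed
    also have "\<dots> = (\<Prod>j\<in>K. emeasure std_exponential {c j * y<..})"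
      using K by (simp add: P.emeasure_PiM sets_PiM_I_finite)
    also have "\<dots> = (\<Prod>j\<in>K. ennreal (exp (- (c j * y))))"
      using c y K by (intro prod.cong refl emeasure_std_exponential_greaterThan) auto
    also have "\<dots> = ennreal (exp (- ((\<Sum>j\<in>K. c j) * y)))"
      using K by (simp add: prod_ennreal exp_sum[symmetric] sum_negf sum_distrib_right)
    finally show "(\<integral>\<^sup>+ x. indicator ?A (x(a := y)) \<partial>PiM K (\<lambda>_. std_exponential))
       = ennreal (exp (- ((\<Sum>j\<in>K. c j) * y)))" .
  qed
  also have "\<dots> = ennreal (1 / (1 + (\<Sum>j\<in>K. c j)))"
    using c K by (intro nn_integral_std_exponential_exp sum_nonneg) auto
  finally show ?thesis by (simp add: K_def)
qed

text \<open>A finite form of the Poisson matching lemma. The encoder's weights p(u|x) are copied to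
  all \<open>L\<close> bins, so their total is \<open>L\<close>; the decoder's weights live in one
  bin and have total at most 1. On \<open>G\<close> the weight p(u|x) / L exceeds the decoder's
  weight by a factor of at most \<open>\<eta>\<close>, which limits how often the two races
  disagree.\<close>

lemma one_shot_wyner_ziv:
  fixes P :: "'w pmf" and X :: "'w \<Rightarrow> 'x" and Z :: "'w \<Rightarrow> 'z"
    and \<kappa> :: "'x \<Rightarrow> 'u pmf" and \<rho> :: "'z \<Rightarrow> 'u \<Rightarrow> real" and G :: "('w \<times> 'u) set"
  assumes finP: "finite (set_pmf P)" and finA: "finite A" and L: "0 < L" and \<eta>: "0 \<le> \<eta>"
    and supp: "\<And>w. w \<in> set_pmf P \<Longrightarrow> set_pmf (\<kappa> (X w)) \<subseteq> A"
    and \<rho>_nonneg: "\<And>z u. 0 \<le> \<rho> z u"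
    and \<rho>_sum: "\<And>w. w \<in> set_pmf P \<Longrightarrow> (\<Sum>u\<in>A. \<rho> (Z w) u) \<le> 1"
    and dens: "\<And>w u. w \<in> set_pmf P \<Longrightarrow> u \<in> set_pmf (\<kappa> (X w)) \<Longrightarrow> (w, u) \<in> G \<Longrightarrow>
                 pmf (\<kappa> (X w)) u \<le> \<eta> * real L * \<rho> (Z w) u"
  obtains enc :: "'x \<Rightarrow> nat" and dec :: "nat \<Rightarrow> 'z \<Rightarrow> 'u"
  where "\<And>x. enc x \<in> {1..L}"
    and "measure_pmf.prob P {w. (w, dec (enc (X w)) (Z w)) \<in> G}
           \<ge> measure_pmf.prob (P \<bind> (\<lambda>w. map_pmf (Pair w) (\<kappa> (X w)))) G / (1 + \<eta>)"
proof -
  define I where "I = A \<times> {1..L}"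
  have finI: "finite I" using finA by (simp add: I_def)
  define M where "M = PiM I (\<lambda>_. std_exponential)"
  interpret E: prob_space std_exponential by (rule prob_space_std_exponential)
  interpret M: prob_space M unfolding M_def by (rule prob_space_PiM) (rule prob_space_std_exponential)
  \<comment> \<open>Minimality of \<open>T a / r a\<close>, cross-multiplied so that weights 0 need
    no division. Strictness rules out ties and makes a winner unique.\<close>
  define win :: "('u \<times> nat \<Rightarrow> real) \<Rightarrow> ('u \<times> nat \<Rightarrow> real) \<Rightarrow> 'u \<times> nat \<Rightarrow> bool"
    where "win r T a \<longleftrightarrow> a \<in> I \<and> (\<forall>j\<in>I - {a}. r j * T a < r a * T j)" for r T a
  have win_unique: "a = b" if "win r T a" "win r T b" for r T a b
    using that unfolding win_def by (metis DiffI empty_iff insert_iff less_asym mult.commute)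
  have the_win: "(THE a. win r T a) = a" if "win r T a" for r T a
    using that win_unique by blast
  define pe :: "'x \<Rightarrow> 'u \<times> nat \<Rightarrow> real" where "pe x j = pmf (\<kappa> x) (fst j)" for x j
  define de :: "nat \<Rightarrow> 'z \<Rightarrow> 'u \<times> nat \<Rightarrow> real"
    where "de m z j = (if snd j = m then \<rho> z (fst j) else 0)" for m z j
  \<comment> \<open>The value 1 for a race without winner keeps the message in range. Such
    realisations never count as successes.\<close>
  define enc where "enc T x = (if \<exists>a. win (pe x) T a then snd (THE a. win (pe x) T a) else 1)" for T x
  define dec where "dec T m z = fst (THE a. win (de m z) T a)" for T m z
  have enc_range: "enc T x \<in> {1..L}" for T x
  proof (cases "\<exists>a. win (pe x) T a")
    case True
    then obtain a where a: "win (pe x) T a" by blast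
    then have "enc T x = snd a" unfolding enc_def using the_win[OF a] by metis
    then show ?thesis using a by (auto simp: win_def I_def)
  qed (use L in \<open>simp add: enc_def\<close>)
  \<comment> \<open>The larger of the two ratios is the threshold beyond which clock j loses both
    the encoder's and the decoder's race to \<open>a\<close>, so both wins become one instance of
    \<open>exponential_race\<close>.\<close>
  define c where "c w a j = max (pe (X w) j / pe (X w) a) (de (snd a) (Z w) j / de (snd a) (Z w) a)" for w a j
  define Ev where "Ev w a = {T \<in> space M. 0 \<le> T a \<and> (\<forall>j\<in>I - {a}. c w a j * T a < T j)}" for w a
  have Ev_meas [measurable]: "Ev w a \<in> sets M" if "a \<in> I" for w a
    unfolding Ev_def M_def using finI that by (auto intro!: sets.sets_Collect_finite_All' sets.sets_Collect_conj)
  define S where "S w = {u \<in> set_pmf (\<kappa> (X w)). (w, u) \<in> G}" for w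
  have S: "S w \<subseteq> A" if "w \<in> set_pmf P" for w using supp[OF that] by (auto simp: S_def)
  have finS: "finite (S w)" if "w \<in> set_pmf P" for w using S[OF that] finA finite_subset by blast
  have pos: "0 < pmf (\<kappa> (X w)) u" "0 < \<rho> (Z w) u"
    if "w \<in> set_pmf P" "u \<in> S w" for w u
  proof -
    show 1: "0 < pmf (\<kappa> (X w)) u" using that by (auto simp: S_def pmf_positive)
    with dens[of w u] that show "0 < \<rho> (Z w) u"
      using \<rho>_nonneg[of "Z w" u] by (auto simp: S_def order.strict_iff_order)
  qed
  have measure_Ev: "measure M (Ev w (u, m)) \<ge> pmf (\<kappa> (X w)) u / L / (1 + \<eta>)"
    if w: "w \<in> set_pmf P" and u: "u \<in> S w" and m: "m \<in> {1..L}" for w u m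
  proof -
    define p q where "p = pmf (\<kappa> (X w)) u" and "q = \<rho> (Z w) u"
    have p: "0 < p" and q: "0 < q" using pos[OF w u] by (auto simp: p_def q_def)
    have pq: "p \<le> \<eta> * L * q" using dens[OF w] u by (auto simp: S_def p_def q_def)
    have a: "(u, m) \<in> I" using S[OF w] u m by (auto simp: I_def)
    have c0: "0 \<le> c w (u, m) j" for j
      using \<rho>_nonneg by (auto simp: c_def pe_def de_def le_max_iff_disj)
    have sum_pe: "(\<Sum>j\<in>I. pe (X w) j) = L"
    proof -
      have "(\<Sum>j\<in>I. pe (X w) j) = (\<Sum>u\<in>A. \<Sum>m\<in>{1..L}. pmf (\<kappa> (X w)) u)"
        unfolding I_def by (subst sum.cartesian_product) (auto simp: pe_def intro!: sum.cong)
      also have "\<dots> = L * (\<Sum>u\<in>A. pmf (\<kappa> (X w)) u)" by (simp add: sum_distrib_left)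
      also have "(\<Sum>u\<in>A. pmf (\<kappa> (X w)) u) = 1" by (rule sum_pmf_eq_1[OF finA supp[OF w]])
      finally show ?thesis by simp
    qed
    have sum_de: "(\<Sum>j\<in>I. de m (Z w) j) \<le> 1"
    proof -
      have "(\<Sum>j\<in>I. de m (Z w) j) = (\<Sum>u\<in>A. \<Sum>m'\<in>{1..L}. if m' = m then \<rho> (Z w) u else 0)"
        unfolding I_def by (subst sum.cartesian_product) (auto simp: de_def intro!: sum.cong)
      also have "\<dots> = (\<Sum>u\<in>A. \<rho> (Z w) u)" using m by (simp add: sum.delta)
      also have "\<dots> \<le> 1" using \<rho>_sum[OF w] .
      finally show ?thesis .
    qed
    text \<open>Bounding the maximum in \<open>c\<close> by the sum gives the matching probability
      \<open>1 / (L / p + 1 / q)\<close>.\<close>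
    have "1 + (\<Sum>j\<in>I - {(u, m)}. c w (u, m) j)
        \<le> 1 + (\<Sum>j\<in>I - {(u, m)}. pe (X w) j / p + de m (Z w) j / q)"
      using m p q by (intro add_left_mono sum_mono)
         (auto simp: c_def p_def q_def pe_def de_def intro!: divide_nonneg_nonneg \<rho>_nonneg)
    \<comment> \<open>The summand at \<open>(u, m)\<close> itself is 1 + 1, which absorbs the
      leading 1.\<close>
    also have "\<dots> \<le> (\<Sum>j\<in>I. pe (X w) j / p + de m (Z w) j / q)"
      using finI a p q by (subst (2) sum.remove[of _ "(u, m)"])
        (auto simp: pe_def de_def p_def q_def)
    also have "\<dots> = (\<Sum>j\<in>I. pe (X w) j) / p + (\<Sum>j\<in>I. de m (Z w) j) / q"
      by (simp add: sum.distrib sum_divide_distrib)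
    also have "\<dots> \<le> L / p + 1 / q"
      using sum_pe sum_de q by (simp add: divide_right_mono)
    also have "\<dots> \<le> (1 + \<eta>) * L / p"
      using pq p q by (simp add: field_simps)
    finally have bound: "1 + (\<Sum>j\<in>I - {(u, m)}. c w (u, m) j) \<le> (1 + \<eta>) * L / p" .
    have cs: "0 \<le> (\<Sum>j\<in>I - {(u, m)}. c w (u, m) j)" using c0 by (intro sum_nonneg) auto
    have "measure M (Ev w (u, m)) = 1 / (1 + (\<Sum>j\<in>I - {(u, m)}. c w (u, m) j))"
      using exponential_race[OF finI a, of "c w (u, m)"] c0 cs
      by (simp add: measure_def Ev_def M_def)
    also have "\<dots> \<ge> 1 / ((1 + \<eta>) * L / p)"
      using bound cs by (intro divide_left_mono) (auto intro!: mult_pos_pos divide_pos_pos p simp: L add_nonneg_pos add_pos_nonneg \<eta>)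
    finally show ?thesis by (simp add: p_def field_simps)
  qed
  have win_Ev: "win (pe (X w)) T (u, m)" "win (de m (Z w)) T (u, m)"
    if w: "w \<in> set_pmf P" and u: "u \<in> S w" and m: "m \<in> {1..L}" and T: "T \<in> Ev w (u, m)" for w u m T
  proof -
    have a: "(u, m) \<in> I" using S[OF w] u m by (auto simp: I_def)
    have T0: "0 \<le> T (u, m)" and Tc: "c w (u, m) j * T (u, m) < T j" if "j \<in> I - {(u, m)}" for j
      using T that by (auto simp: Ev_def)
    have key: "r j * T (u, m) < r (u, m) * T j"
      if r: "0 < r (u, m)" "r j / r (u, m) \<le> c w (u, m) j" and j: "j \<in> I - {(u, m)}" for r j
    proof -
      have "r j / r (u, m) * T (u, m) \<le> c w (u, m) j * T (u, m)"
        using r(2) T0[OF j] by (rule mult_right_mono)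
      also have "\<dots> < T j" using Tc[OF j] .
      finally show ?thesis using r(1) by (simp add: field_simps)
    qed
    show "win (pe (X w)) T (u, m)" "win (de m (Z w)) T (u, m)"
      unfolding win_def using pos[OF w u]
      by (intro conjI ballI key a; simp add: c_def pe_def de_def)+
  qed
  have decoded: "(w, dec T (enc T (X w)) (Z w)) \<in> G"
    if w: "w \<in> set_pmf P" and u: "u \<in> S w" and m: "m \<in> {1..L}" and T: "T \<in> Ev w (u, m)" for w u m T
  proof -
    have "enc T (X w) = m"
      unfolding enc_def using win_Ev(1)[OF w u m T] the_win[OF win_Ev(1)[OF w u m T]] by (metis snd_conv)
    moreover have "dec T m (Z w) = u"
      unfolding dec_def using the_win[OF win_Ev(2)[OF w u m T]] by simp
    ultimately show ?thesis using u by (simp add: S_def)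
  qed
  have disj: "a = b" if w: "w \<in> set_pmf P" and a: "a \<in> S w \<times> {1..L}" "b \<in> S w \<times> {1..L}"
    and T: "T \<in> Ev w a" "T \<in> Ev w b" for w a b T
    using win_Ev(1)[OF w, of "fst a" "snd a" T] win_Ev(1)[OF w, of "fst b" "snd b" T] win_unique a T
    by (metis mem_Sigma_iff prod.collapse)
  \<comment> \<open>A lower bound for the success probability built from finitely many events
    \<open>Ev\<close>. Only these must be measurable; measurability of \<open>enc\<close> and
    \<open>dec\<close> in the clocks never arises.\<close>
  define F where "F T = (\<Sum>w\<in>set_pmf P. pmf P w * (\<Sum>a\<in>S w \<times> {1..L}. indicator (Ev w a) T))" for T
  define good where "good T = {w. (w, dec T (enc T (X w)) (Z w)) \<in> G}" for T
  define \<theta> where "\<theta> = measure_pmf.prob (P \<bind> (\<lambda>w. map_pmf (Pair w) (\<kappa> (X w)))) G"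
  have SI: "a \<in> I" if "w \<in> set_pmf P" "a \<in> S w \<times> {1..L}" for w a
    using S that by (auto simp: I_def)
  have F_le: "F T \<le> measure_pmf.prob P (good T)" for T
  proof -
    have "(\<Sum>a\<in>S w \<times> {1..L}. indicator (Ev w a) T) \<le> (indicator (good T) w :: real)"
      if w: "w \<in> set_pmf P" for w
    proof (cases "\<exists>a\<in>S w \<times> {1..L}. T \<in> Ev w a")
      case True
      then obtain a where a: "a \<in> S w \<times> {1..L}" "T \<in> Ev w a" by blast
      have "(\<Sum>b\<in>S w \<times> {1..L}. indicator (Ev w b) T) = (\<Sum>b\<in>S w \<times> {1..L}. if b = a then 1 else 0 :: real)"
      proof (intro sum.cong refl)
        fix b assume b: "b \<in> S w \<times> {1..L}"
        have "T \<in> Ev w b \<longleftrightarrow> b = a" using disj[OF w b a(1)] a(2) by blast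
        then show "indicator (Ev w b) T = (if b = a then 1 else 0 :: real)" by (simp add: indicator_def)
      qed
      also have "\<dots> = 1" using a(1) finS[OF w] by (simp add: sum.delta)
      also have "1 = (indicator (good T) w :: real)"
        using a decoded[OF w] by (cases a) (auto simp: good_def)
      finally show ?thesis by simp
    next
      case False
      then have "(\<Sum>a\<in>S w \<times> {1..L}. indicator (Ev w a) T) = (0 :: real)"
        by (intro sum.neutral) auto
      then show ?thesis by simp
    qed
    then have "F T \<le> (\<Sum>w\<in>set_pmf P. pmf P w * indicator (good T) w)"
      unfolding F_def by (intro sum_mono mult_left_mono) auto
    also have "\<dots> = measure_pmf.expectation P (indicator (good T))"
      using finP by (subst integral_measure_pmf[of "set_pmf P"]) auto
    also have "\<dots> = measure_pmf.prob P (good T)" by simp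
    finally show ?thesis .
  qed
  have int_Ev: "integrable M (\<lambda>T. indicator (Ev w a) T :: real)" if "a \<in> I" for w a
    using that by (intro integrable_real_indicator) (auto simp: M.emeasure_eq_measure)
  have int_F: "integrable M F"
    unfolding F_def
    by (intro Bochner_Integration.integrable_sum integrable_mult_right int_Ev SI)
  have "\<theta> = (\<Sum>w\<in>set_pmf P. pmf P w * measure_pmf.prob (\<kappa> (X w)) (S w))"
  proof -
    have "\<theta> = measure_pmf.expectation (P \<bind> (\<lambda>w. map_pmf (Pair w) (\<kappa> (X w)))) (indicator G)"
      by (simp add: \<theta>_def)
    also have "\<dots> = (\<Sum>w\<in>set_pmf P. pmf P w *\<^sub>R
                      measure_pmf.expectation (map_pmf (Pair w) (\<kappa> (X w))) (indicator G))"
      using finP supp finA by (intro pmf_expectation_bind) (auto intro: finite_subset)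
    also have "\<dots> = (\<Sum>w\<in>set_pmf P. pmf P w * measure_pmf.prob (\<kappa> (X w)) (S w))"
    proof (intro sum.cong refl)
      fix w
      have "measure_pmf.expectation (map_pmf (Pair w) (\<kappa> (X w))) (indicator G)
          = measure_pmf.prob (map_pmf (Pair w) (\<kappa> (X w))) G" by (simp del: integral_map_pmf measure_map_pmf)
      also have "\<dots> = measure_pmf.prob (\<kappa> (X w)) (Pair w -` G)" by simp
      also have "\<dots> = measure_pmf.prob (\<kappa> (X w)) (S w)"
        by (rule measure_pmf.finite_measure_eq_AE) (auto simp: S_def AE_measure_pmf_iff)
      finally show "pmf P w *\<^sub>R measure_pmf.expectation (map_pmf (Pair w) (\<kappa> (X w))) (indicator G)
        = pmf P w * measure_pmf.prob (\<kappa> (X w)) (S w)" by simp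
    qed
    finally show ?thesis .
  qed
  \<comment> \<open>Each of the \<open>L\<close> bins carries a share 1 / L, so summing over the
    bins restores p(u|x).\<close>
  also have "\<dots> / (1 + \<eta>) = (\<Sum>w\<in>set_pmf P. pmf P w * (\<Sum>a\<in>S w \<times> {1..L}. pmf (\<kappa> (X w)) (fst a) / L / (1 + \<eta>)))"
    unfolding sum_divide_distrib
  proof (intro sum.cong refl)
    fix w assume w: "w \<in> set_pmf P"
    have "(\<Sum>a\<in>S w \<times> {1..L}. pmf (\<kappa> (X w)) (fst a) / L / (1 + \<eta>))
       = (\<Sum>u\<in>S w. \<Sum>m\<in>{1..L}. pmf (\<kappa> (X w)) u / L / (1 + \<eta>))"
      by (subst sum.cartesian_product) (auto intro!: sum.cong)
    also have "\<dots> = (\<Sum>u\<in>S w. pmf (\<kappa> (X w)) u) / (1 + \<eta>)"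
      using L by (simp add: sum_divide_distrib)
    also have "(\<Sum>u\<in>S w. pmf (\<kappa> (X w)) u) = measure_pmf.prob (\<kappa> (X w)) (S w)"
      using finS[OF w] by (simp add: measure_measure_pmf_finite)
    finally show "pmf P w * measure_pmf.prob (\<kappa> (X w)) (S w) / (1 + \<eta>)
        = pmf P w * (\<Sum>a\<in>S w \<times> {1..L}. pmf (\<kappa> (X w)) (fst a) / L / (1 + \<eta>))"
      by simp
  qed
  also have "\<dots> \<le> (\<Sum>w\<in>set_pmf P. pmf P w * (\<Sum>a\<in>S w \<times> {1..L}. measure M (Ev w a)))"
    using measure_Ev by (intro sum_mono mult_left_mono) auto
  also have "\<dots> = M.expectation F"
    unfolding F_def
  proof -
    have sum_int: "(\<integral>T. (\<Sum>a\<in>S w \<times> {1..L}. indicator (Ev w a) T) \<partial>M) = (\<Sum>a\<in>S w \<times> {1..L}. measure M (Ev w a))"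
      if w: "w \<in> set_pmf P" for w
    proof -
      have "(\<integral>T. (\<Sum>a\<in>S w \<times> {1..L}. indicator (Ev w a) T) \<partial>M)
          = (\<Sum>a\<in>S w \<times> {1..L}. \<integral>T. (indicator (Ev w a) T :: real) \<partial>M)"
        by (rule Bochner_Integration.integral_sum) (intro int_Ev SI[OF w])
      also have "\<dots> = (\<Sum>a\<in>S w \<times> {1..L}. measure M (Ev w a))"
        by (intro sum.cong refl) (simp add: Ev_def Int_def conj_commute)
      finally show ?thesis .
    qed
    have "(\<integral>T. (\<Sum>w\<in>set_pmf P. pmf P w * (\<Sum>a\<in>S w \<times> {1..L}. indicator (Ev w a) T)) \<partial>M)
        = (\<Sum>w\<in>set_pmf P. \<integral>T. pmf P w * (\<Sum>a\<in>S w \<times> {1..L}. indicator (Ev w a) T) \<partial>M)"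
      by (rule Bochner_Integration.integral_sum)
         (intro integrable_mult_right Bochner_Integration.integrable_sum int_Ev SI)
    also have "\<dots> = (\<Sum>w\<in>set_pmf P. pmf P w * (\<Sum>a\<in>S w \<times> {1..L}. measure M (Ev w a)))"
      by (intro sum.cong refl) (simp only: integral_mult_right_zero sum_int)
    finally show "(\<Sum>w\<in>set_pmf P. pmf P w * (\<Sum>a\<in>S w \<times> {1..L}. measure M (Ev w a)))
        = (\<integral>T. (\<Sum>w\<in>set_pmf P. pmf P w * (\<Sum>a\<in>S w \<times> {1..L}. indicator (Ev w a) T)) \<partial>M)" by simp
  qed
  finally have \<theta>_le: "\<theta> / (1 + \<eta>) \<le> M.expectation F" .
  obtain T where "\<theta> / (1 + \<eta>) \<le> F T"
    using M.expectation_less[OF int_F, of "\<theta> / (1 + \<eta>)"] \<theta>_le by (force simp: not_le)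
  then have "\<theta> / (1 + \<eta>) \<le> measure_pmf.prob P (good T)" using F_le[of T] by linarith
  then show thesis
    using enc_range by (intro that[of "enc T" "dec T"]) (auto simp: good_def \<theta>_def)
qed

section \<open>Entropies of finitely supported distributions\<close>

lemma expectation_finite_pmf:
  fixes f :: "'a \<Rightarrow> real"
  assumes "finite A" "set_pmf p \<subseteq> A"
  shows "measure_pmf.expectation p f = (\<Sum>x\<in>A. pmf p x * f x)"
  using assms by (subst integral_measure_pmf[of A]) auto

lemma expectation_mono_pmf:
  fixes f g :: "'a \<Rightarrow> real"
  assumes "finite (set_pmf p)" "\<And>x. x \<in> set_pmf p \<Longrightarrow> f x \<le> g x"
  shows "measure_pmf.expectation p f \<le> measure_pmf.expectation p g"
  using assms by (intro integral_mono_AE) (auto simp: integrable_measure_pmf_finite AE_measure_pmf_iff)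

lemma expectation_cong_pmf:
  fixes f g :: "'a \<Rightarrow> real"
  assumes "\<And>x. x \<in> set_pmf p \<Longrightarrow> f x = g x"
  shows "measure_pmf.expectation p f = measure_pmf.expectation p g"
  using assms by (intro integral_cong_AE) (auto simp: AE_measure_pmf_iff)

lemma pmf_map_pos:
  assumes "w \<in> set_pmf P"
  shows "0 < pmf (map_pmf X P) (X w)"
  using assms by (simp add: pmf_positive)

text \<open>From ln t <= t - 1 at t = q / p. Admitting sub-probabilities \<open>q\<close> makes it
  applicable to products and mixtures summed only over the support.\<close>

lemma gibbs_inequality:
  assumes fin: "finite (set_pmf p)"
    and pos: "\<And>x. x \<in> set_pmf p \<Longrightarrow> 0 < q x"
    and sub: "(\<Sum>x\<in>set_pmf p. q x) \<le> (1::real)"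
  shows "ent p \<le> measure_pmf.expectation p (\<lambda>x. - log 2 (q x))"
proof -
  have "(\<Sum>x\<in>set_pmf p. pmf p x * (log 2 (q x) - log 2 (pmf p x)))
      \<le> (\<Sum>x\<in>set_pmf p. (q x - pmf p x) / ln 2)"
  proof (rule sum_mono)
    fix x assume x: "x \<in> set_pmf p"
    then have p: "0 < pmf p x" and q: "0 < q x" using pos by (auto simp: pmf_positive)
    have "log 2 (q x) - log 2 (pmf p x) = ln (q x / pmf p x) / ln 2"
      using p q by (simp add: log_def ln_div diff_divide_distrib)
    also have "\<dots> \<le> (q x / pmf p x - 1) / ln 2"
      using p q by (intro divide_right_mono ln_le_minus_one) auto
    finally have "pmf p x * (log 2 (q x) - log 2 (pmf p x)) \<le> pmf p x * ((q x / pmf p x - 1) / ln 2)"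
      using p by (intro mult_left_mono) auto
    also have "\<dots> = (q x - pmf p x) / ln 2" using p by (simp add: field_simps)
    finally show "pmf p x * (log 2 (q x) - log 2 (pmf p x)) \<le> (q x - pmf p x) / ln 2" .
  qed
  also have "\<dots> = ((\<Sum>x\<in>set_pmf p. q x) - (\<Sum>x\<in>set_pmf p. pmf p x)) / ln 2"
    by (simp only: sum_divide_distrib[symmetric] sum_subtractf)
  also have "(\<Sum>x\<in>set_pmf p. pmf p x) = 1" using fin by (simp add: sum_pmf_eq_1)
  also have "((\<Sum>x\<in>set_pmf p. q x) - 1) / ln 2 \<le> 0" using sub by (simp add: divide_nonpos_pos)
  finally show ?thesis
    using fin by (simp add: ent_def expectation_finite_pmf[OF fin] algebra_simps sum_subtractf sum_negf)
qed

lemma ent_map_expectation: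
  assumes "finite (set_pmf P)"
  shows "ent (map_pmf X P) = measure_pmf.expectation P (\<lambda>w. - log 2 (pmf (map_pmf X P) (X w)))"
proof -
  have "ent (map_pmf X P) = measure_pmf.expectation (map_pmf X P) (\<lambda>x. - log 2 (pmf (map_pmf X P) x))"
    using assms unfolding ent_def
    by (subst expectation_finite_pmf[of "set_pmf (map_pmf X P)"]) (auto simp: sum_negf)
  then show ?thesis by simp
qed

lemma ent_map_inj:
  assumes "inj_on f (set_pmf p)"
  shows "ent (map_pmf f p) = ent p"
proof -
  have "(\<Sum>x\<in>f ` set_pmf p. pmf (map_pmf f p) x * log 2 (pmf (map_pmf f p) x))
      = (\<Sum>x\<in>set_pmf p. pmf p x * log 2 (pmf p x))"
    using assms by (subst sum.reindex) (auto simp: pmf_map_inj intro!: sum.cong)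
  then show ?thesis by (simp add: ent_def)
qed

text \<open>Entropy depends only on the partition that a variable induces on the support. This
  serves to reorder tuples and to drop components that are functions of the others.\<close>

lemma ent_map_inj':
  assumes "\<And>w w'. w \<in> set_pmf P \<Longrightarrow> w' \<in> set_pmf P \<Longrightarrow> X w = X w' \<longleftrightarrow> Y w = Y w'"
  shows "ent (map_pmf X P) = ent (map_pmf Y P)"
proof -
  define f where "f x = Y (SOME w. w \<in> set_pmf P \<and> X w = x)" for x
  have f: "f (X w) = Y w" if "w \<in> set_pmf P" for w
  proof -
    have "(SOME w'. w' \<in> set_pmf P \<and> X w' = X w) \<in> set_pmf P \<and> X (SOME w'. w' \<in> set_pmf P \<and> X w' = X w) = X w"
      by (rule someI_ex) (use that in blast)
    then show ?thesis using assms that by (auto simp: f_def)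
  qed
  have "map_pmf Y P = map_pmf f (map_pmf X P)"
    unfolding pmf.map_comp by (intro map_pmf_cong refl) (simp add: f)
  moreover have "inj_on f (set_pmf (map_pmf X P))"
    using f assms by (auto intro!: inj_onI)
  ultimately show ?thesis by (simp add: ent_map_inj)
qed

lemma cent_cong:
  assumes "\<And>w w'. w \<in> set_pmf P \<Longrightarrow> w' \<in> set_pmf P \<Longrightarrow> X w = X w' \<longleftrightarrow> X' w = X' w'"
    and "\<And>w w'. w \<in> set_pmf P \<Longrightarrow> w' \<in> set_pmf P \<Longrightarrow> Y w = Y w' \<longleftrightarrow> Y' w = Y' w'"
  shows "cent P X Y = cent P X' Y'"
  unfolding cent_def
  by (intro arg_cong2[where f = "(-)"] ent_map_inj') (use assms in auto)

lemma cent_expectation: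
  assumes fin: "finite (set_pmf P)"
  shows "cent P X Y = measure_pmf.expectation P
     (\<lambda>w. - log 2 (pmf (map_pmf (\<lambda>w. (X w, Y w)) P) (X w, Y w) / pmf (map_pmf Y P) (Y w)))"
proof -
  have "cent P X Y = measure_pmf.expectation P (\<lambda>w. - log 2 (pmf (map_pmf (\<lambda>w. (X w, Y w)) P) (X w, Y w)))
      - measure_pmf.expectation P (\<lambda>w. - log 2 (pmf (map_pmf Y P) (Y w)))"
    unfolding cent_def by (simp only: ent_map_expectation[OF fin])
  also have "\<dots> = measure_pmf.expectation P (\<lambda>w. - log 2 (pmf (map_pmf (\<lambda>w. (X w, Y w)) P) (X w, Y w))
     - - log 2 (pmf (map_pmf Y P) (Y w)))"
    by (rule Bochner_Integration.integral_diff[symmetric]) (auto simp: fin integrable_measure_pmf_finite)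
  also have "\<dots> = measure_pmf.expectation P
     (\<lambda>w. - log 2 (pmf (map_pmf (\<lambda>w. (X w, Y w)) P) (X w, Y w) / pmf (map_pmf Y P) (Y w)))"
  proof (rule expectation_cong_pmf)
    fix w assume w: "w \<in> set_pmf P"
    show "- log 2 (pmf (map_pmf (\<lambda>w. (X w, Y w)) P) (X w, Y w)) - - log 2 (pmf (map_pmf Y P) (Y w))
      = - log 2 (pmf (map_pmf (\<lambda>w. (X w, Y w)) P) (X w, Y w) / pmf (map_pmf Y P) (Y w))"
      using pmf_map_pos[OF w, of Y] pmf_map_pos[OF w, of "\<lambda>w. (X w, Y w)"] by (simp add: log_divide)
  qed
  finally show ?thesis .
qed

text \<open>Gibbs' inequality for the joint law against q(x, y) p(y). All upper bounds on
  conditional entropies below are instances, each with its own predictor \<open>q\<close>.\<close>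

lemma cent_le_cross:
  fixes q :: "'a \<Rightarrow> 'b \<Rightarrow> real"
  assumes fin: "finite (set_pmf P)"
    and pos: "\<And>w. w \<in> set_pmf P \<Longrightarrow> 0 < q (X w) (Y w)"
    and nonneg: "\<And>x y. 0 \<le> q x y"
    and sub: "\<And>w. w \<in> set_pmf P \<Longrightarrow> (\<Sum>x\<in>X ` set_pmf P. q x (Y w)) \<le> 1"
  shows "cent P X Y \<le> measure_pmf.expectation P (\<lambda>w. - log 2 (q (X w) (Y w)))"
proof -
  let ?XY = "map_pmf (\<lambda>w. (X w, Y w)) P" and ?Y = "map_pmf Y P"
  have "ent ?XY \<le> measure_pmf.expectation ?XY (\<lambda>x. - log 2 (case x of (x, y) \<Rightarrow> q x y * pmf ?Y y))"
  proof (rule gibbs_inequality)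
    show "finite (set_pmf ?XY)" using fin by simp
    show "0 < (case x of (x, y) \<Rightarrow> q x y * pmf ?Y y)" if "x \<in> set_pmf ?XY" for x
      using that pos pmf_map_pos[of _ P Y] by auto
    have "(\<Sum>x\<in>set_pmf ?XY. case x of (x, y) \<Rightarrow> q x y * pmf ?Y y)
        \<le> (\<Sum>x\<in>X ` set_pmf P \<times> Y ` set_pmf P. case x of (x, y) \<Rightarrow> q x y * pmf ?Y y)"
      using fin nonneg by (intro sum_mono2) auto
    also have "\<dots> = (\<Sum>y\<in>Y ` set_pmf P. (\<Sum>x\<in>X ` set_pmf P. q x y) * pmf ?Y y)"
      by (subst sum.cartesian_product[symmetric], subst sum.swap) (simp add: sum_distrib_right)
    also have "\<dots> \<le> (\<Sum>y\<in>Y ` set_pmf P. 1 * pmf ?Y y)"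
      using sub by (intro sum_mono mult_right_mono) auto
    also have "\<dots> = 1" using fin by (simp add: sum_pmf_eq_1)
    finally show "(\<Sum>x\<in>set_pmf ?XY. case x of (x, y) \<Rightarrow> q x y * pmf ?Y y) \<le> 1" .
  qed
  also have "measure_pmf.expectation ?XY (\<lambda>x. - log 2 (case x of (x, y) \<Rightarrow> q x y * pmf ?Y y))
    = measure_pmf.expectation P (\<lambda>w. - log 2 (q (X w) (Y w)) + - log 2 (pmf ?Y (Y w)))"
    unfolding integral_map_pmf
  proof (rule expectation_cong_pmf)
    fix w assume w: "w \<in> set_pmf P"
    show "- log 2 (case (X w, Y w) of (x, y) \<Rightarrow> q x y * pmf ?Y y)
        = - log 2 (q (X w) (Y w)) + - log 2 (pmf ?Y (Y w))"
      using pos[OF w] pmf_map_pos[OF w, of Y] by (simp add: log_mult)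
  qed
  also have "\<dots> = measure_pmf.expectation P (\<lambda>w. - log 2 (q (X w) (Y w))) + ent ?Y"
    unfolding ent_map_expectation[OF fin]
    by (rule Bochner_Integration.integral_add) (auto simp: fin integrable_measure_pmf_finite)
  finally show ?thesis by (simp add: cent_def)
qed

lemma pmf_pair_le_right:
  "pmf (map_pmf (\<lambda>w. (X w, Y w)) P) (x, y) \<le> pmf (map_pmf Y P) y"
  unfolding pmf_map by (intro measure_pmf.finite_measure_mono) auto

lemma sum_pmf_pair_le:
  assumes "finite A"
  shows "(\<Sum>x\<in>A. pmf (map_pmf (\<lambda>w. (X w, Y w)) P) (x, y)) \<le> pmf (map_pmf Y P) y"
proof -
  have "(\<Sum>x\<in>A. pmf (map_pmf (\<lambda>w. (X w, Y w)) P) (x, y))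
      = measure_pmf.prob (map_pmf (\<lambda>w. (X w, Y w)) P) ((\<lambda>x. (x, y)) ` A)"
    using assms by (subst measure_measure_pmf_finite) (auto simp: sum.reindex inj_on_def)
  also have "\<dots> \<le> pmf (map_pmf Y P) y"
    unfolding pmf_map measure_map_pmf by (intro measure_pmf.finite_measure_mono) auto
  finally show ?thesis .
qed

lemma cent_nonneg:
  assumes fin: "finite (set_pmf P)"
  shows "0 \<le> cent P X Y"
  unfolding cent_expectation[OF fin]
proof (rule integral_nonneg_AE, unfold AE_measure_pmf_iff, safe)
  fix w assume w: "w \<in> set_pmf P"
  show "0 \<le> - log 2 (pmf (map_pmf (\<lambda>w. (X w, Y w)) P) (X w, Y w) / pmf (map_pmf Y P) (Y w))"
    using pmf_map_pos[OF w, of Y] pmf_map_pos[OF w, of "\<lambda>w. (X w, Y w)"]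
      pmf_pair_le_right[of X Y P "X w" "Y w"] by (simp add: log_le_zero_cancel_iff)
qed

text \<open>The law p(x|z) is an admissible predictor from (u, z): it simply ignores u.\<close>

lemma cent_cond_le:
  fixes P :: "'a pmf" and X :: "'a \<Rightarrow> 'b" and U :: "'a \<Rightarrow> 'c" and Z :: "'a \<Rightarrow> 'd"
  assumes fin: "finite (set_pmf P)"
  shows "cent P X (\<lambda>w. (U w, Z w)) \<le> cent P X Z"
proof -
  define q where "q x y = pmf (map_pmf (\<lambda>w. (X w, Z w)) P) (x, snd y) / pmf (map_pmf Z P) (snd y)"
    for x and y :: "'c \<times> 'd"
  have "cent P X (\<lambda>w. (U w, Z w)) \<le> measure_pmf.expectation P (\<lambda>w. - log 2 (q (X w) (U w, Z w)))"
  proof (rule cent_le_cross[OF fin])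
    fix w assume w: "w \<in> set_pmf P"
    show "0 < q (X w) (U w, Z w)"
      using pmf_map_pos[OF w, of Z] pmf_map_pos[OF w, of "\<lambda>w. (X w, Z w)"] by (simp add: q_def)
    show "(\<Sum>x\<in>X ` set_pmf P. q x (U w, Z w)) \<le> 1"
      using pmf_map_pos[OF w, of Z] sum_pmf_pair_le[of "X ` set_pmf P" X Z P "Z w"] fin
      by (simp add: q_def sum_divide_distrib[symmetric])
  qed (simp add: q_def)
  then show ?thesis by (simp add: q_def cent_expectation[OF fin, of X Z])
qed

lemma cent_le_ent:
  assumes fin: "finite (set_pmf P)"
  shows "cent P X Y \<le> ent (map_pmf X P)"
  unfolding ent_map_expectation[OF fin, of X]
  by (rule cent_le_cross[OF fin, where q = "\<lambda>x _. pmf (map_pmf X P) x"])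
     (use fin in \<open>auto simp: pmf_map_pos sum_pmf_eq_1\<close>)

lemma ent_le_log_card:
  assumes fin: "finite A" and sub: "set_pmf p \<subseteq> A"
  shows "ent p \<le> log 2 (card A)"
proof -
  have fin': "finite (set_pmf p)" using assms finite_subset by blast
  have A: "0 < card A" using assms set_pmf_not_empty[of p] by (auto simp: card_gt_0_iff)
  have "ent p \<le> measure_pmf.expectation p (\<lambda>x. - log 2 (1 / card A))"
    using A card_mono[OF fin sub] by (intro gibbs_inequality[OF fin']) (auto simp: field_simps)
  also have "\<dots> = log 2 (card A)" using A by (simp add: log_divide)
  finally show ?thesis .
qed

text \<open>Words of length n are functions on all naturals with a fixed default from n on. They are
  determined by their restriction to \<open>{..<n}\<close>, so the sum is at most the product of the
  coordinate sums.\<close>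

lemma sum_prod_fun_le_1:
  fixes g :: "nat \<Rightarrow> 'a \<Rightarrow> real" and F :: "(nat \<Rightarrow> 'a) set"
  assumes fin: "finite F"
    and dflt: "\<And>x i. x \<in> F \<Longrightarrow> n \<le> i \<Longrightarrow> x i = c"
    and nonneg: "\<And>i a. 0 \<le> g i a"
    and sub: "\<And>i A. finite A \<Longrightarrow> sum (g i) A \<le> 1"
  shows "(\<Sum>x\<in>F. \<Prod>i<n. g i (x i)) \<le> 1"
proof -
  define A where "A i = (\<lambda>x. x i) ` F" for i
  have finA: "finite (A i)" for i using fin by (simp add: A_def)
  have inj: "inj_on (\<lambda>x. restrict x {..<n}) F"
  proof (rule inj_onI)
    fix x x' assume x: "x \<in> F" "x' \<in> F" "restrict x {..<n} = restrict x' {..<n}"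
    show "x = x'"
    proof
      fix i show "x i = x' i"
      proof (cases "i < n")
        case True then show ?thesis using fun_cong[OF x(3), of i] by simp
      next
        case False then show ?thesis using dflt[OF x(1), of i] dflt[OF x(2), of i] by simp
      qed
    qed
  qed
  have "(\<Sum>x\<in>F. \<Prod>i<n. g i (x i)) = (\<Sum>x\<in>(\<lambda>x. restrict x {..<n}) ` F. \<Prod>i<n. g i (x i))"
    by (subst sum.reindex[OF inj]) simp
  also have "\<dots> \<le> (\<Sum>x\<in>PiE {..<n} A. \<Prod>i<n. g i (x i))"
    using nonneg finA by (intro sum_mono2 finite_PiE)
      (auto simp: A_def PiE_iff extensional_def split: if_splits intro!: prod_nonneg)
  also have "\<dots> = (\<Prod>i<n. \<Sum>x\<in>A i. g i x)"
    using finA by (subst prod_sum_PiE) auto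
  also have "\<dots> \<le> 1"
    using nonneg finA sub by (intro prod_le_1) (auto intro!: sum_nonneg)
  finally show ?thesis .
qed

text \<open>The predictor is the product of the single-letter conditional laws given
  \<open>Y\<close>; its cross entropy is exactly the right-hand side, so no chain rule is
  required.\<close>

lemma cent_fun_le_sum:
  fixes X :: "'w \<Rightarrow> nat \<Rightarrow> 'a"
  assumes fin: "finite (set_pmf P)"
    and dflt: "\<And>w i. w \<in> set_pmf P \<Longrightarrow> n \<le> i \<Longrightarrow> X w i = c"
  shows "cent P X Y \<le> (\<Sum>i<n. cent P (\<lambda>w. X w i) Y)"
proof -
  define r where "r i x y = pmf (map_pmf (\<lambda>w. (X w i, Y w)) P) (x, y) / pmf (map_pmf Y P) y" for i x y
  have r_pos: "0 < r i (X w i) (Y w)" if "w \<in> set_pmf P" for i w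
    using pmf_map_pos[OF that, of Y] pmf_map_pos[OF that, of "\<lambda>w. (X w i, Y w)"] by (simp add: r_def)
  have r_nonneg: "0 \<le> r i x y" for i x y by (simp add: r_def)
  have "cent P X Y \<le> measure_pmf.expectation P (\<lambda>w. - log 2 (\<Prod>i<n. r i (X w i) (Y w)))"
  proof (rule cent_le_cross[OF fin, where q = "\<lambda>x y. \<Prod>i<n. r i (x i) y"])
    fix w assume w: "w \<in> set_pmf P"
    show "0 < (\<Prod>i<n. r i (X w i) (Y w))" using r_pos[OF w] by (intro prod_pos) auto
    show "(\<Sum>x\<in>X ` set_pmf P. \<Prod>i<n. r i (x i) (Y w)) \<le> 1"
    proof (rule sum_prod_fun_le_1)
      show "sum (\<lambda>x. r i x (Y w)) A \<le> 1" if "finite A" for i A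
        using sum_pmf_pair_le[OF that, of "\<lambda>w. X w i" Y P "Y w"] pmf_map_pos[OF w, of Y]
        by (simp add: r_def sum_divide_distrib[symmetric])
    qed (use fin dflt r_nonneg in auto)
  qed (auto intro!: prod_nonneg r_nonneg)
  also have "\<dots> = measure_pmf.expectation P (\<lambda>w. \<Sum>i<n. - log 2 (r i (X w i) (Y w)))"
  proof (rule expectation_cong_pmf)
    fix w assume "w \<in> set_pmf P"
    from r_pos[OF this] show "- log 2 (\<Prod>i<n. r i (X w i) (Y w)) = (\<Sum>i<n. - log 2 (r i (X w i) (Y w)))"
      by (induction n) (auto simp: log_mult prod_pos lessThan_Suc less_imp_neq[symmetric])
  qed
  also have "\<dots> = (\<Sum>i<n. cent P (\<lambda>w. X w i) Y)"
    unfolding cent_expectation[OF fin] r_def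
    by (rule Bochner_Integration.integral_sum) (auto simp: fin integrable_measure_pmf_finite)
  finally show ?thesis .
qed

lemma finite_set_Pi_pmf:
  assumes "finite A" "\<And>i. i \<in> A \<Longrightarrow> finite (set_pmf (p i))"
  shows "finite (set_pmf (Pi_pmf A dflt p))"
  using assms by (subst set_Pi_pmf) (auto intro!: finite_PiE_dflt)

lemma expectation_sum_iid:
  fixes h :: "'a \<Rightarrow> real"
  assumes "finite (set_pmf p)"
  shows "measure_pmf.expectation (Pi_pmf {..<n} dflt (\<lambda>_. p)) (\<lambda>x. \<Sum>i<n. h (x i))
       = real n * measure_pmf.expectation p h"
proof -
  have "measure_pmf.expectation (Pi_pmf {..<n} dflt (\<lambda>_. p)) (\<lambda>x. h (x i)) = measure_pmf.expectation p h"
    if "i < n" for i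
    using that integral_map_pmf[of "\<lambda>x. x i" "Pi_pmf {..<n} dflt (\<lambda>_. p)" h]
    by (simp add: Pi_pmf_component)
  then show ?thesis
    using assms by (subst Bochner_Integration.integral_sum)
      (auto intro!: integrable_measure_pmf_finite finite_set_Pi_pmf)
qed

text \<open>Hoeffding's inequality gives an exponential rate; afterwards only convergence to 0
  matters.\<close>

lemma weak_law:
  fixes f :: "'a \<Rightarrow> real"
  assumes finp: "finite (set_pmf p)" and \<epsilon>: "0 < \<epsilon>"
  shows "(\<lambda>n. measure_pmf.prob (Pi_pmf {..<n} dflt (\<lambda>_. p))
            {x. (\<Sum>i<n. f (x i)) \<ge> real n * (measure_pmf.expectation p f + \<epsilon>)}) \<longlonglongrightarrow> 0"
proof (rule tendsto_sandwich[OF _ _ tendsto_const])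
  \<comment> \<open>The added 1 keeps \<open>a < b\<close> even for constant \<open>f\<close>, so
    that \<open>K\<close> does not divide by 0.\<close>
  define a b where "a = Min (f ` set_pmf p)" and "b = Max (f ` set_pmf p) + 1"
  have ab: "a \<le> f x" "f x \<le> b" "f x < b" if "x \<in> set_pmf p" for x
  proof -
    have "f x \<le> Max (f ` set_pmf p)" using finp that by (intro Max_ge) auto
    then show "f x \<le> b" "f x < b" by (auto simp: b_def)
    show "a \<le> f x" unfolding a_def using finp that by (intro Min_le) auto
  qed
  then have "a < b" using set_pmf_not_empty[of p] by fastforce
  define K where "K = 2 * \<epsilon>\<^sup>2 / (b - a)\<^sup>2"
  have K: "0 < K" using \<epsilon> \<open>a < b\<close> by (simp add: K_def)
  let ?P = "\<lambda>n. Pi_pmf {..<n} dflt (\<lambda>_. p)"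
  show "eventually (\<lambda>n. measure_pmf.prob (?P n) {x. (\<Sum>i<n. f (x i)) \<ge> real n * (measure_pmf.expectation p f + \<epsilon>)}
     \<le> exp (- K * real n)) sequentially"
  proof (rule eventually_sequentiallyI[of 1])
    fix n :: nat assume n: "1 \<le> n"
    interpret Hoeffding_ineq "measure_pmf (?P n)" "{..<n}" "\<lambda>i x. f (x i)" "\<lambda>_. a" "\<lambda>_. b"
      "\<Sum>i<n. measure_pmf.expectation (?P n) (\<lambda>x. f (x i))"
    proof unfold_locales
      show "prob_space.indep_vars (measure_pmf (?P n)) (\<lambda>_. borel) (\<lambda>i x. f (x i)) {..<n}"
        using prob_space.indep_vars_compose2[OF measure_pmf.prob_space_axioms
            indep_vars_Pi_pmf[of "{..<n}" dflt "\<lambda>_. p"], of "\<lambda>_. f" "\<lambda>_. borel"] by simp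
      show "AE x in measure_pmf (?P n). f (x i) \<in> {a..b}" if "i \<in> {..<n}" for i
        using ab that by (auto simp: AE_measure_pmf_iff set_Pi_pmf PiE_dflt_def)
    qed auto
    have "(\<Sum>i<n. measure_pmf.expectation (?P n) (\<lambda>x. f (x i))) = real n * measure_pmf.expectation p f"
      using expectation_sum_iid[OF finp, of n dflt f] finp
      by (subst (asm) Bochner_Integration.integral_sum)
         (auto intro!: integrable_measure_pmf_finite finite_set_Pi_pmf)
    moreover have "-2 * (real n * \<epsilon>)\<^sup>2 / (\<Sum>i<n. (b - a)\<^sup>2) = - K * real n"
      using n by (simp add: K_def power_mult_distrib power2_eq_square[of "real n"])
    ultimately show "measure_pmf.prob (?P n) {x. (\<Sum>i<n. f (x i)) \<ge> real n * (measure_pmf.expectation p f + \<epsilon>)}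
     \<le> exp (- K * real n)"
      using Hoeffding_ineq_ge[of "real n * \<epsilon>"] \<epsilon> n \<open>a < b\<close> by (simp add: algebra_simps)
  qed
  show "(\<lambda>n. exp (- K * real n)) \<longlonglongrightarrow> 0" using K by real_asymp
qed auto

lemma ent_Pi_pmf:
  assumes fin: "finite (set_pmf p)"
  shows "ent (Pi_pmf {..<n} dflt (\<lambda>_. p)) = real n * ent p"
proof -
  let ?P = "Pi_pmf {..<n} dflt (\<lambda>_. p)"
  have finP: "finite (set_pmf ?P)"
    using fin by (subst set_Pi_pmf) (auto intro!: finite_PiE_dflt)
  have "ent ?P = measure_pmf.expectation ?P (\<lambda>x. - log 2 (pmf ?P x))"
    using ent_map_expectation[OF finP, of "\<lambda>x. x"] by (simp add: pmf.map_ident)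
  also have "\<dots> = measure_pmf.expectation ?P (\<lambda>x. \<Sum>i<n. - log 2 (pmf p (x i)))"
  proof (rule expectation_cong_pmf)
    fix x assume x: "x \<in> set_pmf ?P"
    then have x': "x i \<in> set_pmf p" if "i < n" for i
      using that by (subst (asm) set_Pi_pmf) (auto simp: PiE_dflt_def)
    have "pmf ?P x = (\<Prod>i<n. pmf p (x i))"
      using x by (subst pmf_Pi') (auto dest: subsetD[OF set_Pi_pmf_subset, rotated])
    moreover have "- log 2 (\<Prod>i<n. pmf p (x i)) = (\<Sum>i<n. - log 2 (pmf p (x i)))"
      using x' by (induction n) (auto simp: log_mult prod_pos lessThan_Suc pmf_positive less_imp_neq[symmetric])
    ultimately show "- log 2 (pmf ?P x) = (\<Sum>i<n. - log 2 (pmf p (x i)))" by simp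
  qed
  also have "\<dots> = (\<Sum>i<n. measure_pmf.expectation p (\<lambda>y. - log 2 (pmf p y)))"
    using expectation_sum_iid[OF fin, of n dflt "\<lambda>y. - log 2 (pmf p y)"] by simp
  also have "\<dots> = real n * ent p"
    using ent_map_expectation[OF fin, of "\<lambda>x. x"] by (simp add: pmf.map_ident)
  finally show ?thesis .
qed

section \<open>Achievability\<close>

lemma pmf_bind_Pair:
  "pmf (p \<bind> (\<lambda>x. map_pmf (Pair x) (k x))) (x, u) = pmf p x * pmf (k x) u"
proof -
  have "pmf (map_pmf (Pair x') (k x')) (x, u) = indicator {x} x' * pmf (k x) u" for x'
  proof (cases "x' = x")
    case True
    then show ?thesis by (simp add: pmf_map_inj' inj_def)
  next
    case False
    then show ?thesis by (auto simp: pmf_eq_0_set_pmf)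
  qed
  then have "pmf (p \<bind> (\<lambda>x. map_pmf (Pair x) (k x))) (x, u)
      = measure_pmf.expectation p (\<lambda>x'. indicator {x} x' * pmf (k x) u)"
    by (simp add: pmf_bind)
  also have "\<dots> = pmf p x * pmf (k x) u" by (simp add: pmf.rep_eq)
  finally show ?thesis .
qed

text \<open>Drawing n independent pairs amounts to drawing the word x and then u letter by letter
  from x. This carries the weak law for i.i.d. pairs over to a source word with its code
  word.\<close>

lemma Pi_pmf_bind_Pair:
  assumes fin: "finite A"
  shows "Pi_pmf A (a, b) (\<lambda>_. p \<bind> (\<lambda>x. map_pmf (Pair x) (k x)))
       = map_pmf (\<lambda>(f, g) i. if i \<in> A then (f i, g i) else (a, b))
           (Pi_pmf A a (\<lambda>_. p) \<bind> (\<lambda>f. map_pmf (Pair f) (Pi_pmf A b (\<lambda>i. k (f i)))))"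
proof -
  have "Pi_pmf A (a, b) (\<lambda>_. p \<bind> (\<lambda>x. map_pmf (Pair x) (k x)))
      = Pi_pmf A a (\<lambda>_. p) \<bind> (\<lambda>f. Pi_pmf A (a, b) (\<lambda>i. k (f i) \<bind> (\<lambda>u. return_pmf (f i, u))))"
    unfolding map_pmf_def by (rule Pi_pmf_bind[OF fin])
  also have "\<dots> = Pi_pmf A a (\<lambda>_. p) \<bind> (\<lambda>f. Pi_pmf A b (\<lambda>i. k (f i)) \<bind>
      (\<lambda>g. return_pmf (\<lambda>i. if i \<in> A then (f i, g i) else (a, b))))"
    by (subst Pi_pmf_bind[OF fin, where d' = b]) (simp add: Pi_pmf_return_pmf[OF fin])
  also have "\<dots> = map_pmf (\<lambda>(f, g) i. if i \<in> A then (f i, g i) else (a, b))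
           (Pi_pmf A a (\<lambda>_. p) \<bind> (\<lambda>f. map_pmf (Pair f) (Pi_pmf A b (\<lambda>i. k (f i)))))"
    by (simp add: map_pmf_def bind_assoc_pmf bind_return_pmf)
  finally show ?thesis .
qed

lemma prob_Pi_bind_Pair:
  fixes h :: "'a \<times> 'b \<Rightarrow> real" and n :: nat
  shows "measure_pmf.prob (Pi_pmf {..<n} a (\<lambda>_. p) \<bind> (\<lambda>f. map_pmf (Pair f) (Pi_pmf {..<n} b (\<lambda>i. k (f i)))))
           {(f, g). (\<Sum>i<n. h (f i, g i)) \<ge> t}
       = measure_pmf.prob (Pi_pmf {..<n} (a, b) (\<lambda>_. p \<bind> (\<lambda>x. map_pmf (Pair x) (k x))))
           {y. (\<Sum>i<n. h (y i)) \<ge> t}"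
  unfolding Pi_pmf_bind_Pair[OF finite_lessThan]
  by (simp add: vimage_def case_prod_unfold)

text \<open>Unlike \<open>joint\<close>, this keeps the source triple as one component and allows
  any type for U: the converse uses a message paired with a word of side information.\<close>

definition test_joint ::
  "('r \<times> 'h \<times> 'z) pmf \<Rightarrow> ('r \<times> 'h \<Rightarrow> 'u pmf) \<Rightarrow> (('r \<times> 'h \<times> 'z) \<times> 'u) pmf" where
  "test_joint src Q = src \<bind> (\<lambda>s. map_pmf (Pair s) (Q (fst s, fst (snd s))))"

abbreviation (input) sr :: "('r \<times> 'h \<times> 'z) \<Rightarrow> 'r" where "sr s \<equiv> fst s"
abbreviation (input) sh :: "('r \<times> 'h \<times> 'z) \<Rightarrow> 'h" where "sh s \<equiv> fst (snd s)"
abbreviation (input) sz :: "('r \<times> 'h \<times> 'z) \<Rightarrow> 'z" where "sz s \<equiv> snd (snd s)"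
abbreviation (input) sx :: "('r \<times> 'h \<times> 'z) \<Rightarrow> 'r \<times> 'h" where "sx s \<equiv> (fst s, fst (snd s))"

lemma joint_eq_map:
  "joint src Q = map_pmf (\<lambda>(s, u). (sr s, sh s, sz s, u)) (test_joint src Q)"
  by (auto simp: joint_def test_joint_def map_bind_pmf pmf.map_comp o_def split: prod.splits
      intro!: bind_pmf_cong)

lemma cent_map: "cent (map_pmf f P) X Y = cent P (\<lambda>w. X (f w)) (\<lambda>w. Y (f w))"
  by (simp add: cent_def pmf.map_comp o_def)

lemma minf_map: "minf (map_pmf f P) X Y = minf P (\<lambda>w. X (f w)) (\<lambda>w. Y (f w))"
  by (simp add: minf_def pmf.map_comp o_def)

section \<open>The rate of a test channel as a conditional mutual information\<close>

locale test_channel =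
  fixes src :: "('r::finite \<times> 'h::finite \<times> 'z::finite) pmf"
    and Q :: "'r \<times> 'h \<Rightarrow> nat pmf"
  assumes aux: "aux_ok Q"
begin

abbreviation "J \<equiv> test_joint src Q"

lemma finite_J [simp]: "finite (set_pmf J)"
proof -
  have "finite (set_pmf (Q a))" for a
    using aux unfolding aux_ok_def by (blast intro: finite_subset)
  then show ?thesis by (simp add: test_joint_def)
qed

lemma map_fst_J: "map_pmf (\<lambda>w. f (fst w)) J = map_pmf f src"
  by (simp add: test_joint_def map_bind_pmf pmf.map_comp o_def bind_return_pmf'[of "map_pmf f src"]
      map_pmf_def bind_assoc_pmf bind_return_pmf)

text \<open>Here \<open>f s\<close> is any part of the source letter that still determines (x_r,
  x_h). Comparing \<open>f\<close> = \<open>sx\<close> with \<open>f\<close> = \<open>id\<close>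
  yields H(U|X) = H(U|X,Z), the Markov condition in entropy form.\<close>

lemma markov:
  assumes "\<And>s. sx s = g (f s)"
  shows "pmf (map_pmf (\<lambda>w. (snd w, f (fst w))) J) (u, f s) = pmf (map_pmf f src) (f s) * pmf (Q (sx s)) u"
proof -
  have "map_pmf (\<lambda>w. (f (fst w), snd w)) J = map_pmf f src \<bind> (\<lambda>y. map_pmf (Pair y) (Q (g y)))"
    by (simp add: test_joint_def map_bind_pmf bind_map_pmf pmf.map_comp o_def assms)
  from arg_cong[OF this, of "\<lambda>p. pmf p (f s, u)"]
  have "pmf (map_pmf (\<lambda>w. (f (fst w), snd w)) J) (f s, u) = pmf (map_pmf f src) (f s) * pmf (Q (sx s)) u"
    by (simp add: pmf_bind_Pair assms)
  moreover have "pmf (map_pmf (\<lambda>w. (snd w, f (fst w))) J) (u, f s) = pmf (map_pmf (\<lambda>w. (f (fst w), snd w)) J) (f s, u)"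
    unfolding pmf_map by (intro arg_cong2[where f = measure]) auto
  ultimately show ?thesis by simp
qed

lemma cent_aux_markov:
  assumes "\<And>s. sx s = g (f s)"
  shows "cent J snd (\<lambda>w. f (fst w)) = measure_pmf.expectation J (\<lambda>w. - log 2 (pmf (Q (sx (fst w))) (snd w)))"
  unfolding cent_expectation[OF finite_J]
proof (rule expectation_cong_pmf)
  fix w assume w: "w \<in> set_pmf J"
  have "0 < pmf (map_pmf f src) (f (fst w))"
    using pmf_map_pos[OF w, of "\<lambda>w. f (fst w)"] by (simp add: map_fst_J)
  then show "- log 2 (pmf (map_pmf (\<lambda>w. (snd w, f (fst w))) J) (snd w, f (fst w)) / pmf (map_pmf (\<lambda>w. f (fst w)) J) (f (fst w)))
      = - log 2 (pmf (Q (sx (fst w))) (snd w))"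
    using markov[where f = f and g = g, OF assms, where s = "fst w" and u = "snd w"] by (simp add: map_fst_J)
qed

definition rate :: real where
  "rate = minf (joint src Q) (\<lambda>(xr, xh, z, u). (xh, xr)) (\<lambda>(xr, xh, z, u). u)
        - minf (joint src Q) (\<lambda>(xr, xh, z, u). z) (\<lambda>(xr, xh, z, u). u)"

lemma rate_eq_aux: "rate = cent J snd (\<lambda>w. sz (fst w)) - cent J snd (\<lambda>w. sx (fst w))"
proof -
  have "ent (map_pmf (\<lambda>w. (sh (fst w), sr (fst w))) J) = ent (map_pmf (\<lambda>w. sx (fst w)) J)"
    by (rule ent_map_inj') auto
  moreover have "ent (map_pmf (\<lambda>w. ((sh (fst w), sr (fst w)), snd w)) J) = ent (map_pmf (\<lambda>w. (snd w, sx (fst w))) J)"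
    by (rule ent_map_inj') auto
  moreover have "ent (map_pmf (\<lambda>w. (sz (fst w), snd w)) J) = ent (map_pmf (\<lambda>w. (snd w, sz (fst w))) J)"
    by (rule ent_map_inj') auto
  ultimately show ?thesis
    unfolding rate_def joint_eq_map minf_map by (simp add: minf_def cent_def case_prod_beta)
qed

text \<open>The Markov condition turns H(U|Z) - H(U|X) into H(U|Z) - H(U|X,Z) = I(X;U|Z), which is
  then expanded the other way. In this form only H(X|U,Z) depends on the channel, and both halves of
  the proof use it.\<close>

lemma rate_eq: "rate = cent src sx sz - cent J (\<lambda>w. sx (fst w)) (\<lambda>w. (snd w, sz (fst w)))"
proof -
  have "cent J snd (\<lambda>w. sx (fst w)) = cent J snd (\<lambda>w. id (fst w))"
    using cent_aux_markov[where g = id and f = sx] cent_aux_markov[where g = sx and f = id] by simp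
  moreover have "ent (map_pmf (\<lambda>w. (snd w, id (fst w))) J) = ent (map_pmf (\<lambda>w. (sx (fst w), snd w, sz (fst w))) J)"
    by (rule ent_map_inj') auto
  moreover have "cent src sx sz = cent J (\<lambda>w. sx (fst w)) (\<lambda>w. sz (fst w))"
    by (simp add: cent_def map_fst_J[of sz] map_fst_J[of "\<lambda>s. (sx s, sz s)"])
  moreover have "ent (map_pmf (\<lambda>w. id (fst w)) J) = ent (map_pmf (\<lambda>w. (sx (fst w), sz (fst w))) J)"
    by (rule ent_map_inj') auto
  ultimately show ?thesis by (simp add: rate_eq_aux cent_def)
qed

end

lemma prod_eq_powr_sum_log:
  assumes "\<And>i. i < n \<Longrightarrow> 0 < c i"
  shows "(\<Prod>i<n. c i) = 2 powr (\<Sum>i<n::nat. log 2 (c i))"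
  using assms by (induction n) (auto simp: powr_add)

text \<open>As the message is a function of (A, B), the chain rule gives H(A,B|Z) = H(W|Z) +
  H(B|W,Z) + H(A|B,W,Z), and H(W|Z) <= log L.\<close>

lemma equivocation_lower:
  assumes fin: "finite (set_pmf P)" and W: "\<And>w. w \<in> set_pmf P \<Longrightarrow> W w = g (A w) (B w)"
    and range: "\<And>w. w \<in> set_pmf P \<Longrightarrow> W w \<in> {1..L::nat}"
  shows "cent P (\<lambda>w. (A w, B w)) Z - log 2 L - cent P A (\<lambda>w. (B w, W w, Z w)) \<le> cent P B (\<lambda>w. (W w, Z w))"
proof -
  have "ent (map_pmf (\<lambda>w. (A w, B w, W w, Z w)) P) = ent (map_pmf (\<lambda>w. ((A w, B w), Z w)) P)"
    by (rule ent_map_inj') (auto simp: W)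
  moreover have "cent P W Z \<le> log 2 L"
    using cent_le_ent[OF fin, of W Z] ent_le_log_card[of "{1..L}" "map_pmf W P"] range
    by force
  ultimately show ?thesis by (simp add: cent_def)
qed

lemma finite_set_src_n: "finite (set_pmf (src_n (src :: ('r::finite \<times> 'h::finite \<times> 'z::finite) pmf) n))"
  unfolding src_n_def by (intro finite_set_Pi_pmf) auto

lemma cent_src_n:
  fixes src :: "('r::finite \<times> 'h::finite \<times> 'z::finite) pmf"
  shows "cent (src_n src n) (\<lambda>w i. sx (w i)) (\<lambda>w i. sz (w i)) = n * cent src sx sz"
proof -
  have "ent (map_pmf (\<lambda>w. ((\<lambda>i. sx (w i)), (\<lambda>i. sz (w i)))) (src_n src n)) = ent (map_pmf (\<lambda>w. w) (src_n src n))"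
    by (rule ent_map_inj') (auto simp: fun_eq_iff prod_eq_iff)
  also have "\<dots> = n * ent src" by (simp add: pmf.map_ident src_n_def ent_Pi_pmf)
  also have "ent src = ent (map_pmf (\<lambda>s. (sx s, sz s)) src)"
    by (rule ent_map_inj[symmetric]) (auto simp: inj_on_def)
  finally have 1: "ent (map_pmf (\<lambda>w. ((\<lambda>i. sx (w i)), (\<lambda>i. sz (w i)))) (src_n src n))
    = n * ent (map_pmf (\<lambda>s. (sx s, sz s)) src)" .
  have "map_pmf (\<lambda>w i. sz (w i)) (src_n src n)
      = Pi_pmf {..<n} (sz (undefined :: 'r \<times> 'h \<times> 'z)) (\<lambda>_. map_pmf sz src)"
    unfolding src_n_def by (subst Pi_pmf_map[of _ _ undefined]) (simp_all add: comp_def[abs_def])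
  then have "ent (map_pmf (\<lambda>w i. sz (w i)) (src_n src n)) = n * ent (map_pmf sz src)"
    by (simp add: ent_Pi_pmf)
  with 1 show ?thesis by (simp add: cent_def right_diff_distrib)
qed

section \<open>Block codes for a test channel and their leakage\<close>

context test_channel
begin

lemma rate_nonneg: "0 \<le> rate"
proof -
  have "cent src sx sz = cent J (\<lambda>w. sx (fst w)) (\<lambda>w. sz (fst w))"
    by (simp add: cent_def map_fst_J[of sz] map_fst_J[of "\<lambda>s. (sx s, sz s)"])
  then show ?thesis using cent_cond_le[OF finite_J, of "\<lambda>w. sx (fst w)" snd "\<lambda>w. sz (fst w)"]
    by (simp add: rate_eq)
qed

text \<open>\<open>dens z u\<close> is p(u|z) and \<open>leak\<close> below is p(x_r|x_h,z,u); both are 0 where the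
  conditioning event is null.\<close>

definition dens :: "'z \<Rightarrow> nat \<Rightarrow> real" where
  "dens z u = pmf (map_pmf (\<lambda>w. (snd w, sz (fst w))) J) (u, z) / pmf (map_pmf (\<lambda>w. sz (fst w)) J) z"

text \<open>The information density of I(X;U|Z): by the Markov condition p(u|x) equals
  p(u|x,z).\<close>

definition info :: "('r \<times> 'h \<times> 'z) \<times> nat \<Rightarrow> real" where
  "info w = log 2 (pmf (Q (sx (fst w))) (snd w)) - log 2 (dens (sz (fst w)) (snd w))"

lemma expectation_info: "measure_pmf.expectation J info = rate"
proof -
  have "cent J snd (\<lambda>w. sx (fst w)) = measure_pmf.expectation J (\<lambda>w. - log 2 (pmf (Q (sx (fst w))) (snd w)))"
    using cent_aux_markov[where g = id and f = sx] by simp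
  moreover have "cent J snd (\<lambda>w. sz (fst w)) = measure_pmf.expectation J (\<lambda>w. - log 2 (dens (sz (fst w)) (snd w)))"
    by (simp add: cent_expectation[OF finite_J] dens_def)
  ultimately have "rate = measure_pmf.expectation J (\<lambda>w. - log 2 (dens (sz (fst w)) (snd w)))
     - measure_pmf.expectation J (\<lambda>w. - log 2 (pmf (Q (sx (fst w))) (snd w)))"
    by (simp add: rate_eq_aux)
  also have "\<dots> = measure_pmf.expectation J (\<lambda>w. - log 2 (dens (sz (fst w)) (snd w)) - - log 2 (pmf (Q (sx (fst w))) (snd w)))"
    by (rule Bochner_Integration.integral_diff[symmetric]) (auto intro: integrable_measure_pmf_finite)
  finally show ?thesis by (simp add: info_def[abs_def])
qed

lemma dens_nonneg: "0 \<le> dens z u" by (simp add: dens_def)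

lemma dens_pos: "w \<in> set_pmf J \<Longrightarrow> 0 < dens (sz (fst w)) (snd w)"
  using pmf_map_pos[of w J "\<lambda>w. sz (fst w)"] pmf_map_pos[of w J "\<lambda>w. (snd w, sz (fst w))"]
  by (simp add: dens_def)

lemma sum_dens_le: "finite A \<Longrightarrow> (\<Sum>u\<in>A. dens z u) \<le> 1"
  using sum_pmf_pair_le[of A snd "\<lambda>w. sz (fst w)" J z]
  by (cases "pmf (map_pmf (\<lambda>w. sz (fst w)) J) z = 0")
     (auto simp: dens_def sum_divide_distrib[symmetric] divide_le_eq_1 pmf_nonneg order.strict_iff_order)

lemma set_J: "(s, u) \<in> set_pmf J \<longleftrightarrow> s \<in> set_pmf src \<and> u \<in> set_pmf (Q (sx s))"
  by (auto simp: test_joint_def)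

definition leak :: "('r \<times> 'h \<times> 'z) \<times> nat \<Rightarrow> real" where
  "leak w = pmf (map_pmf (\<lambda>w. (sr (fst w), sh (fst w), sz (fst w), snd w)) J) (sr (fst w), sh (fst w), sz (fst w), snd w)
     / pmf (map_pmf (\<lambda>w. (sh (fst w), sz (fst w), snd w)) J) (sh (fst w), sz (fst w), snd w)"

text \<open>What later estimates require of a decoded word: the support condition keeps
  \<open>leak\<close> positive, and the two sums control distortion and leakage. Typicality of
  \<open>info\<close> matters only inside the coding step and is added there.\<close>

definition good ::
  "('r \<Rightarrow> 'r \<Rightarrow> real) \<Rightarrow> (nat \<Rightarrow> 'z \<Rightarrow> 'r) \<Rightarrow> real \<Rightarrow> nat \<Rightarrow>
    (nat \<Rightarrow> 'r \<times> 'h \<times> 'z) \<Rightarrow> (nat \<Rightarrow> nat) \<Rightarrow> bool" where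
  "good d \<phi> \<epsilon> n w g \<longleftrightarrow> (\<forall>i<n. (w i, g i) \<in> set_pmf J) \<and>
     (\<Sum>i<n. d (sr (w i)) (\<phi> (g i) (sz (w i))))
       \<le> n * (measure_pmf.expectation J (\<lambda>w. d (sr (fst w)) (\<phi> (snd w) (sz (fst w)))) + \<epsilon>) \<and>
     (\<Sum>i<n. - log 2 (leak (w i, g i)))
       \<le> n * (cent J (\<lambda>w. sr (fst w)) (\<lambda>w. (sh (fst w), sz (fst w), snd w)) + \<epsilon>)"

text \<open>The one-shot lemma for product kernels, with the typical pairs as \<open>G\<close>.
  Three tails of the weak law bound the probability of leaving \<open>G\<close>.\<close>

lemma block_code:
  assumes \<epsilon>: "0 < \<epsilon>" and \<delta>: "0 < \<delta>"
  shows "eventually (\<lambda>n. \<exists>L enc dec. 0 < L \<and> (\<forall>x. enc x \<in> {1..L}) \<and> real L \<le> 2 powr (n * (rate + 3 * \<epsilon>)) \<and>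
     measure_pmf.prob (src_n src n)
       {w. good d \<phi> \<epsilon> n w (dec (enc ((\<lambda>i. sr (w i)), (\<lambda>i. sh (w i)))) (\<lambda>i. sz (w i)))} \<ge> 1 - \<delta>) sequentially"
proof -
  define fd where "fd w = d (sr (fst w)) (\<phi> (snd w) (sz (fst w)))" for w :: "('r \<times> 'h \<times> 'z) \<times> nat"
  define fl where "fl w = - log 2 (leak w)" for w
  \<comment> \<open>The default pair combines the \<open>undefined\<close> of \<open>src_n\<close>
    with the 0 used for code words.\<close>
  define PJ where "PJ n = Pi_pmf {..<n} (undefined, 0) (\<lambda>_. J)" for n :: nat
  define T where "T f n = measure_pmf.prob (PJ n) {y. (\<Sum>i<n. f (y i)) \<ge> real n * (measure_pmf.expectation J f + \<epsilon>)}" for f n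
  have T0: "T f \<longlonglongrightarrow> 0" for f
    unfolding T_def PJ_def by (rule weak_law[OF finite_J \<epsilon>])
  \<comment> \<open>The last summand is the later \<open>\<eta>\<close>: it reserves room within
    \<open>\<delta>\<close> for the factor 1 / (1 + \<open>\<eta>\<close>) of the one-shot
    lemma.\<close>
  have lim: "(\<lambda>n. T fd n + T fl n + T info n + 2 powr (- (real n * \<epsilon>))) \<longlonglongrightarrow> 0 + 0 + 0 + 0"
    by (intro tendsto_add T0) (use \<epsilon> in real_asymp)
  have ev1: "eventually (\<lambda>n. T fd n + T fl n + T info n + 2 powr (- (real n * \<epsilon>)) < \<delta>) sequentially"
    using order_tendstoD(2)[OF lim, of \<delta>] \<delta> by simp
  have ev2: "eventually (\<lambda>n. 1 \<le> real n * \<epsilon>) sequentially"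
    using \<epsilon> by real_asymp
  show ?thesis
    using ev1 ev2
  proof eventually_elim
    case (elim n)
    define K where "K s = Q (sx s)" for s :: "'r \<times> 'h \<times> 'z"
    define \<kappa> where "\<kappa> x = Pi_pmf {..<n} 0 (\<lambda>i. Q (fst x i, snd x i))" for x :: "(nat \<Rightarrow> 'r) \<times> (nat \<Rightarrow> 'h)"
    define \<rho> where "\<rho> z g = (\<Prod>i<n. dens (z i) (g i))" for z g
    define X where "X w = ((\<lambda>i. sr (w i)), (\<lambda>i. sh (w i)))" for w :: "nat \<Rightarrow> 'r \<times> 'h \<times> 'z"
    define Z where "Z w = (\<lambda>i. sz (w i))" for w :: "nat \<Rightarrow> 'r \<times> 'h \<times> 'z"
    define G where "G = {(w, g). good d \<phi> \<epsilon> n w g \<and> (\<Sum>i<n. info (w i, g i)) \<le> n * (rate + \<epsilon>)}"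
    \<comment> \<open>On \<open>G\<close> the density \<open>info\<close> sums to at most n (rate +
      eps). One further n eps in the exponent makes \<open>\<eta>\<close> vanish, and a third one
      pays for rounding up, which at most doubles the size.\<close>
    define L where "L = nat \<lceil>2 powr (n * (rate + 2 * \<epsilon>))\<rceil>"
    define \<eta> where "\<eta> = 2 powr (- (real n * \<epsilon>))"
    have \<eta>: "0 < \<eta>" by (simp add: \<eta>_def)
    have L_ge: "2 powr (n * (rate + 2 * \<epsilon>)) \<le> L" unfolding L_def by linarith
    have L: "0 < L" using L_ge by (metis less_le_trans of_nat_0_less_iff powr_gt_zero zero_neq_numeral)
    have "real L \<le> 2 powr (n * (rate + 2 * \<epsilon>)) + 1"
      unfolding L_def using ceiling_correct[of "2 powr (n * (rate + 2 * \<epsilon>))"] by simp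
    also have "\<dots> \<le> 2 * 2 powr (n * (rate + 2 * \<epsilon>))"
      using rate_nonneg \<epsilon> by (simp add: ge_one_powr_ge_zero)
    also have "\<dots> = 2 powr (1 + n * (rate + 2 * \<epsilon>))" by (simp add: powr_add)
    also have "\<dots> \<le> 2 powr (n * (rate + 3 * \<epsilon>))"
      using elim(2) by (simp add: algebra_simps)
    finally have L_le: "real L \<le> 2 powr (n * (rate + 3 * \<epsilon>))" .
    obtain S where S: "finite S" "\<And>a. set_pmf (Q a) \<subseteq> S" using aux by (auto simp: aux_ok_def)
    define A where "A = PiE_dflt {..<n} 0 (\<lambda>_. S)"
    have finA: "finite A" unfolding A_def using S by (intro finite_PiE_dflt) auto
    have finP: "finite (set_pmf (src_n src n))"
      unfolding src_n_def by (intro finite_set_Pi_pmf) auto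
    have supp: "set_pmf (\<kappa> (X w)) \<subseteq> A" for w
      unfolding \<kappa>_def A_def set_Pi_pmf[OF finite_lessThan] using S(2) by (auto simp: PiE_dflt_def)
    have mem: "(w i, g i) \<in> set_pmf J"
      if "w \<in> set_pmf (src_n src n)" "g \<in> set_pmf (\<kappa> (X w))" "i < n" for w g i
      using that unfolding \<kappa>_def src_n_def set_Pi_pmf[OF finite_lessThan]
      by (auto simp: PiE_dflt_def set_J X_def)
    have sum\<rho>: "(\<Sum>g\<in>A. \<rho> z g) \<le> 1" for z
      unfolding \<rho>_def
      by (rule sum_prod_fun_le_1[where c = 0 and g = "\<lambda>i. dens (z i)"])
         (use finA in \<open>auto simp: A_def PiE_dflt_def dens_nonneg sum_dens_le\<close>)
    have dens_bound: "pmf (\<kappa> (X w)) g \<le> \<eta> * real L * \<rho> (Z w) g"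
      if w: "w \<in> set_pmf (src_n src n)" and g: "g \<in> set_pmf (\<kappa> (X w))" and G: "(w, g) \<in> G" for w g
    proof -
      have pos: "0 < pmf (Q (sx (w i))) (g i)" "0 < dens (sz (w i)) (g i)" if "i < n" for i
        using mem[OF w g that] dens_pos[OF mem[OF w g that]] by (auto simp: set_J pmf_positive)
      have "g \<in> A" using supp g by auto
      then have "pmf (\<kappa> (X w)) g = (\<Prod>i<n. pmf (Q (sx (w i))) (g i))"
        unfolding \<kappa>_def by (subst pmf_Pi') (auto simp: X_def A_def PiE_dflt_def)
      also have "\<dots> = 2 powr (\<Sum>i<n. log 2 (pmf (Q (sx (w i))) (g i)))"
        using pos by (intro prod_eq_powr_sum_log) auto
      also have "\<dots> = 2 powr ((\<Sum>i<n. info (w i, g i)) + (\<Sum>i<n. log 2 (dens (sz (w i)) (g i))))"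
        by (simp add: info_def sum_subtractf)
      also have "\<dots> = 2 powr (\<Sum>i<n. info (w i, g i)) * \<rho> (Z w) g"
        unfolding \<rho>_def using pos by (subst prod_eq_powr_sum_log) (auto simp: Z_def powr_add)
      also have "\<dots> \<le> 2 powr (n * (rate + \<epsilon>)) * \<rho> (Z w) g"
        using G by (intro mult_right_mono) (auto simp: G_def \<rho>_def intro!: prod_nonneg dens_nonneg)
      also have "2 powr (n * (rate + \<epsilon>)) = \<eta> * 2 powr (n * (rate + 2 * \<epsilon>))"
        by (simp add: \<eta>_def powr_add[symmetric] algebra_simps)
      also have "\<eta> * 2 powr (n * (rate + 2 * \<epsilon>)) * \<rho> (Z w) g \<le> \<eta> * real L * \<rho> (Z w) g"
        using L_ge \<eta> by (intro mult_right_mono mult_left_mono) (auto simp: \<rho>_def intro!: prod_nonneg dens_nonneg)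
      finally show ?thesis .
    qed
    obtain enc dec where enc: "\<And>x. enc x \<in> {1..L}"
      and dec: "measure_pmf.prob (src_n src n) {w. (w, dec (enc (X w)) (Z w)) \<in> G}
        \<ge> measure_pmf.prob (src_n src n \<bind> (\<lambda>w. map_pmf (Pair w) (\<kappa> (X w)))) G / (1 + \<eta>)"
    proof (rule one_shot_wyner_ziv[of "src_n src n" A L \<eta> \<kappa> X \<rho> Z G])
      show "0 \<le> \<rho> z u" for z u by (auto simp: \<rho>_def intro!: prod_nonneg dens_nonneg)
    qed (use finP finA L \<eta> supp sum\<rho> dens_bound in auto)
    let ?PG = "src_n src n \<bind> (\<lambda>w. map_pmf (Pair w) (\<kappa> (X w)))"
    have tail: "measure_pmf.prob ?PG {(w, g). (\<Sum>i<n. f (w i, g i)) \<ge> real n * (measure_pmf.expectation J f + \<epsilon>)} = T f n" for f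
    proof -
      have "\<kappa> (X w) = Pi_pmf {..<n} 0 (\<lambda>i. K (w i))" for w by (simp add: \<kappa>_def X_def K_def)
      then show ?thesis
        using prob_Pi_bind_Pair[of n undefined src 0 K "real n * (measure_pmf.expectation J f + \<epsilon>)" f]
        by (simp add: T_def PJ_def test_joint_def src_n_def K_def)
    qed
    have "1 - (T fd n + T fl n + T info n) \<le> measure_pmf.prob ?PG G"
    proof -
      let ?B = "\<lambda>f. {(w, g). (\<Sum>i<n. f (w i, g i)) \<ge> real n * (measure_pmf.expectation J f + \<epsilon>)}"
      have fl: "measure_pmf.expectation J fl = cent J (\<lambda>w. sr (fst w)) (\<lambda>w. (sh (fst w), sz (fst w), snd w))"
        unfolding cent_expectation[OF finite_J] fl_def leak_def ..
      have fd: "measure_pmf.expectation J fd = measure_pmf.expectation J (\<lambda>w. d (sr (fst w)) (\<phi> (snd w) (sz (fst w))))"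
        unfolding fd_def ..
      \<comment> \<open>The inclusion holds almost surely: the support condition in
        \<open>good\<close> is automatic on the support of \<open>?PG\<close>, so leaving
        \<open>G\<close> means violating one of the three sums.\<close>
      have "measure_pmf.prob ?PG (- G) \<le> measure_pmf.prob ?PG (?B fd \<union> ?B fl \<union> ?B info)"
      proof (rule measure_pmf.finite_measure_mono_AE)
        show "AE x in measure_pmf ?PG. x \<in> - G \<longrightarrow> x \<in> ?B fd \<union> ?B fl \<union> ?B info"
          unfolding AE_measure_pmf_iff
        proof (intro ballI impI, rule ccontr)
          fix x assume x: "x \<in> set_pmf ?PG" "x \<in> - G" "x \<notin> ?B fd \<union> ?B fl \<union> ?B info"
          obtain w g where wg: "x = (w, g)" by (cases x)
          with x(1) have w: "w \<in> set_pmf (src_n src n)" and g: "g \<in> set_pmf (\<kappa> (X w))" by auto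
          have "good d \<phi> \<epsilon> n w g"
            unfolding good_def using mem[OF w g] x(3) fl fd by (auto simp: wg fd_def fl_def not_le)
          moreover have "(\<Sum>i<n. info (w i, g i)) \<le> n * (rate + \<epsilon>)"
            using x(3) by (auto simp: wg expectation_info not_le)
          ultimately show False using x(2) by (auto simp: wg G_def)
        qed
      qed auto
      also have "\<dots> \<le> measure_pmf.prob ?PG (?B fd) + measure_pmf.prob ?PG (?B fl) + measure_pmf.prob ?PG (?B info)"
        by (intro order_trans[OF measure_Un_le] add_mono order_refl) auto
      also have "\<dots> = T fd n + T fl n + T info n" by (simp only: tail)
      finally have "measure_pmf.prob ?PG (- G) \<le> T fd n + T fl n + T info n" .
      moreover have "measure_pmf.prob ?PG (- G) = 1 - measure_pmf.prob ?PG G"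
        using measure_pmf.prob_compl[of G ?PG] by (simp add: Compl_eq_Diff_UNIV)
      ultimately show ?thesis by linarith
    qed
    then have PG: "1 - (\<delta> - \<eta>) \<le> measure_pmf.prob ?PG G" using elim(1) by (simp add: \<eta>_def)
    have "(1 - \<delta>) * (1 + \<eta>) \<le> measure_pmf.prob ?PG G"
    proof -
      have "(1 - \<delta>) * (1 + \<eta>) \<le> 1 - (\<delta> - \<eta>)" using \<delta> \<eta> by (simp add: algebra_simps)
      with PG show ?thesis by linarith
    qed
    then have "1 - \<delta> \<le> measure_pmf.prob ?PG G / (1 + \<eta>)" using \<eta> by (simp add: pos_le_divide_eq)
    also note dec
    also have "measure_pmf.prob (src_n src n) {w. (w, dec (enc (X w)) (Z w)) \<in> G}
      \<le> measure_pmf.prob (src_n src n) {w. good d \<phi> \<epsilon> n w (dec (enc ((\<lambda>i. sr (w i)), (\<lambda>i. sh (w i)))) (\<lambda>i. sz (w i)))}"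
      by (intro measure_pmf.finite_measure_mono) (auto simp: G_def X_def Z_def)
    finally show ?case using L L_le enc by blast
  qed
qed

lemma leak_pos: "w \<in> set_pmf J \<Longrightarrow> 0 < leak w"
  unfolding leak_def
  using pmf_map_pos[of w J "\<lambda>w. (sr (fst w), sh (fst w), sz (fst w), snd w)"]
    pmf_map_pos[of w J "\<lambda>w. (sh (fst w), sz (fst w), snd w)"] by simp

lemma leak_nonneg: "0 \<le> leak w" by (simp add: leak_def)

lemma sum_leak_le: "finite A \<Longrightarrow> (\<Sum>a\<in>A. leak ((a, b, z), u)) \<le> 1"
  using sum_pmf_pair_le[of A "\<lambda>w. sr (fst w)" "\<lambda>w. (sh (fst w), sz (fst w), snd w)" J "(b, z, u)"]
  by (cases "pmf (map_pmf (\<lambda>w. (sh (fst w), sz (fst w), snd w)) J) (b, z, u) = 0")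
     (auto simp: leak_def sum_divide_distrib[symmetric] divide_le_eq_1 pmf_nonneg order.strict_iff_order)

lemma card_r_pos: "0 < real CARD('r)" "1 \<le> real CARD('r)"
  by (simp_all add: Suc_leI)

text \<open>The decoded word is a function of the message and the side information, so predicting
  X_r from it is admissible in \<open>cent_le_cross\<close>. On the good event the predictor costs
  the typical amount; elsewhere the cost is that of a uniform guess, weighted with the error
  probability. The leading 1 is the price of the mixing weight 1/2.\<close>

lemma leakage_le:
  fixes P :: "(nat \<Rightarrow> 'r \<times> 'h \<times> 'z) pmf" and W :: "(nat \<Rightarrow> 'r \<times> 'h \<times> 'z) \<Rightarrow> 'b"
  assumes P_def: "P = src_n src n" and \<epsilon>: "0 \<le> \<epsilon>"
    and prob: "measure_pmf.prob P {w. good d \<phi> \<epsilon> n w (dec (W w) (\<lambda>i. sz (w i)))} \<ge> 1 - \<delta>"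
  shows "cent P (\<lambda>w i. sr (w i)) (\<lambda>w. ((\<lambda>i. sh (w i)), W w, (\<lambda>i. sz (w i))))
    \<le> 1 + n * (cent J (\<lambda>w. sr (fst w)) (\<lambda>w. (sh (fst w), sz (fst w), snd w)) + \<epsilon>) + n * log 2 CARD('r) * \<delta>"
proof -
  define H where "H = cent J (\<lambda>w. sr (fst w)) (\<lambda>w. (sh (fst w), sz (fst w), snd w)) + \<epsilon>"
  have H: "0 \<le> H" unfolding H_def using cent_nonneg[OF finite_J] \<epsilon> by (intro add_nonneg_nonneg)
  have finP: "finite (set_pmf P)"
    unfolding P_def src_n_def by (intro finite_set_Pi_pmf) auto
  define Gd where "Gd = {w. good d \<phi> \<epsilon> n w (dec (W w) (\<lambda>i. sz (w i)))}"
  text \<open>Mixing with the uniform distribution keeps the cost on the error event linear in n.\<close>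
  define q where "q a y = (case y of (b, m, z) \<Rightarrow>
      (1/2) * (\<Prod>i<n. leak ((a i, b i, z i), dec m z i)) + (1/2) * (\<Prod>i<n. 1 / real CARD('r)))"
    for a :: "nat \<Rightarrow> 'r" and y :: "(nat \<Rightarrow> 'h) \<times> 'b \<times> (nat \<Rightarrow> 'z)"
  have q_ge: "1/2 * (1 / CARD('r)) ^ n \<le> q a y"
    "1/2 * (\<Prod>i<n. leak ((a i, fst y i, snd (snd y) i), dec (fst (snd y)) (snd (snd y)) i)) \<le> q a y" for a y
    by (auto simp: q_def case_prod_beta intro!: prod_nonneg leak_nonneg)
  have q_pos: "0 < q a y" for a y
    using q_ge(1)[of a y] card_r_pos(1) by (meson less_le_trans divide_pos_pos mult_pos_pos zero_less_one zero_less_power half_gt_zero)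
  have "cent P (\<lambda>w i. sr (w i)) (\<lambda>w. ((\<lambda>i. sh (w i)), W w, (\<lambda>i. sz (w i))))
     \<le> measure_pmf.expectation P (\<lambda>w. - log 2 (q (\<lambda>i. sr (w i)) ((\<lambda>i. sh (w i)), W w, (\<lambda>i. sz (w i)))))"
  proof (rule cent_le_cross[OF finP])
    fix w assume "w \<in> set_pmf P"
    let ?F = "(\<lambda>w i. sr (w i)) ` set_pmf P"
    have dflt: "x i = fst (undefined :: 'r \<times> 'h \<times> 'z)" if "x \<in> ?F" "n \<le> i" for x i
      using that by (auto simp: P_def src_n_def set_Pi_pmf PiE_dflt_def)
    have 1: "(\<Sum>x\<in>?F. \<Prod>i<n. leak ((x i, sh (w i), sz (w i)), dec (W w) (\<lambda>i. sz (w i)) i)) \<le> 1"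
    proof (rule sum_prod_fun_le_1[where c = "fst (undefined :: 'r \<times> 'h \<times> 'z)" and
            g = "\<lambda>i a. leak ((a, sh (w i), sz (w i)), dec (W w) (\<lambda>i. sz (w i)) i)"])
      show "sum (\<lambda>a. leak ((a, sh (w i), sz (w i)), dec (W w) (\<lambda>i. sz (w i)) i)) A \<le> 1" if "finite A" for i A
        by (rule sum_leak_le[OF that])
    qed (use finP dflt leak_nonneg in auto)
    have 2: "(\<Sum>x\<in>?F. \<Prod>i<n. 1 / real CARD('r)) \<le> (1::real)"
    proof (rule sum_prod_fun_le_1[where c = "fst (undefined :: 'r \<times> 'h \<times> 'z)" and g = "\<lambda>i a. 1 / real CARD('r)"])
      show "sum (\<lambda>a. 1 / real CARD('r)) A \<le> 1" for A :: "'r set"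
        using card_mono[of "UNIV :: 'r set" A] card_r_pos by (simp add: divide_le_eq_1)
    qed (use finP dflt in auto)
    show "(\<Sum>x\<in>?F. q x ((\<lambda>i. sh (w i)), W w, (\<lambda>i. sz (w i)))) \<le> 1"
      using 1 2 by (simp only: q_def prod.case sum.distrib sum_distrib_left[symmetric])
  qed (use q_pos in \<open>auto simp: less_imp_le\<close>)
  also have "\<dots> \<le> measure_pmf.expectation P (\<lambda>w. (1 + n * H) + (n * log 2 CARD('r)) * indicator (- Gd) w)"
  proof (rule expectation_mono_pmf[OF finP])
    fix w assume w: "w \<in> set_pmf P"
    let ?q = "q (\<lambda>i. sr (w i)) ((\<lambda>i. sh (w i)), W w, (\<lambda>i. sz (w i)))"
    show "- log 2 ?q \<le> (1 + n * H) + (n * log 2 CARD('r)) * indicator (- Gd) w"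
    proof (cases "w \<in> Gd")
      case True
      let ?u = "dec (W w) (\<lambda>i. sz (w i))"
      have J: "(w i, ?u i) \<in> set_pmf J" if "i < n" for i using True that by (auto simp: Gd_def good_def)
      have "2 powr (- (n * H)) \<le> 2 powr (\<Sum>i<n. log 2 (leak (w i, ?u i)))"
        using True by (auto simp: Gd_def good_def H_def sum_negf)
      also have "\<dots> = (\<Prod>i<n. leak (w i, ?u i))"
        using J by (intro prod_eq_powr_sum_log[symmetric] leak_pos) auto
      finally have "2 powr (- (1 + n * H)) \<le> ?q"
        using q_ge(2)[of "\<lambda>i. sr (w i)" "((\<lambda>i. sh (w i)), W w, (\<lambda>i. sz (w i)))"]
        by (simp add: powr_diff powr_minus_divide)
      then have "log 2 (2 powr (- (1 + n * H))) \<le> log 2 ?q"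
        using q_pos by (subst log_le_cancel_iff) auto
      then show ?thesis using True by simp
    next
      case False
      have "log 2 (1/2 * (1 / CARD('r)) ^ n) \<le> log 2 ?q"
        using q_ge(1) q_pos card_r_pos(1) by (subst log_le_cancel_iff) auto
      also have "log 2 (1/2 * (1 / CARD('r)) ^ n) = - 1 - n * log 2 CARD('r)"
        using card_r_pos(1) by (simp add: log_mult log_divide log_nat_power)
      finally have "- log 2 ?q \<le> 1 + n * log 2 CARD('r)" by simp
      moreover have "0 \<le> n * H" using H by simp
      ultimately show ?thesis using False by simp
    qed
  qed
  also have "\<dots> = (1 + n * H) + (n * log 2 CARD('r)) * measure_pmf.prob P (- Gd)"
    by (subst Bochner_Integration.integral_add) (auto intro: integrable_measure_pmf_finite[OF finP])
  also have "\<dots> \<le> (1 + n * H) + (n * log 2 CARD('r)) * \<delta>"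
  proof -
    have "measure_pmf.prob P (- Gd) = 1 - measure_pmf.prob P Gd"
      using measure_pmf.prob_compl[of Gd P] by (simp add: Compl_eq_Diff_UNIV)
    then show ?thesis using prob card_r_pos(2) by (intro add_left_mono mult_left_mono) (auto simp: Gd_def)
  qed
  finally show ?thesis by (simp add: H_def)
qed

lemma achievability:
  assumes d: "\<And>x y. 0 \<le> d x y"
    and D: "measure_pmf.expectation (joint src Q) (\<lambda>(xr, xh, z, u). d xr (\<phi> u z)) \<le> D"
    and E: "E \<le> cent (joint src Q) (\<lambda>(xr, xh, z, u). xh) (\<lambda>(xr, xh, z, u). (u, z))"
    and R: "rate \<le> R" and \<epsilon>: "0 < \<epsilon>"
  shows "\<exists>n>0. \<exists>M>0. \<exists>FE FD. code_ok src d R D E \<epsilon> n M FE FD"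
proof -
  \<comment> \<open>The equivocation is the most expensive constraint and spends six shares: three
    on the rate, and one each on typical leakage, on its constant 1 and on the error event.\<close>
  define \<epsilon>1 where "\<epsilon>1 = \<epsilon> / 8"
  define B where "B = Max (range (\<lambda>(x, y). d x y))"
  have B: "d x y \<le> B" for x y
    unfolding B_def by (rule Max_ge) (auto intro: image_eqI[of _ _ "(x, y)"])
  have B0: "0 \<le> B" using B[of undefined undefined] d[of undefined undefined] by linarith
  \<comment> \<open>One error probability \<open>\<delta>\<close> must make both the worst
    distortion and the log-alphabet cost of leakage negligible; the added 1 makes \<open>C\<close>
    positive.\<close>
  define C where "C = B + log 2 CARD('r) + 1"
  have C: "0 < C" "B \<le> C" "log 2 CARD('r) \<le> C"
    using B0 card_r_pos(2) by (auto simp: C_def add_nonneg_pos)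
  define \<delta> where "\<delta> = \<epsilon>1 / C"
  have \<epsilon>1: "0 < \<epsilon>1" and \<delta>: "0 < \<delta>" using \<epsilon> C by (auto simp: \<epsilon>1_def \<delta>_def)
  have B\<delta>: "B * \<delta> \<le> \<epsilon>1" and R\<delta>: "log 2 CARD('r) * \<delta> \<le> \<epsilon>1"
    using C \<epsilon>1 by (auto simp: \<delta>_def pos_divide_le_eq mult.commute)
  have "eventually (\<lambda>n. 1 \<le> real n * \<epsilon>1) sequentially" using \<epsilon>1 by real_asymp
  then obtain n :: nat and L enc dec where n\<epsilon>: "1 \<le> real n * \<epsilon>1" and L: "0 < L" "\<And>x. enc x \<in> {1..L}"
      "real L \<le> 2 powr (n * (rate + 3 * \<epsilon>1))"
    and prob: "measure_pmf.prob (src_n src n)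
       {w. good d \<phi> \<epsilon>1 n w (dec (enc ((\<lambda>i. sr (w i)), (\<lambda>i. sh (w i)))) (\<lambda>i. sz (w i)))} \<ge> 1 - \<delta>"
    using eventually_happens'[OF sequentially_bot eventually_conj[OF _ block_code[OF \<epsilon>1 \<delta>, of d \<phi>]]]
    by blast
  have n: "0 < n" using n\<epsilon> by (cases n) auto
  let ?P = "src_n src n"
  have finP: "finite (set_pmf ?P)"
    unfolding src_n_def by (intro finite_set_Pi_pmf) auto
  define W where "W w = enc ((\<lambda>i. sr (w i)), (\<lambda>i. sh (w i)))" for w :: "nat \<Rightarrow> 'r \<times> 'h \<times> 'z"
  define FE where "FE xr xh = enc (xr, xh)" for xr xh
  define FD where "FD m z i = \<phi> (dec m z i) (z i)" for m z i
  have W: "FE (\<lambda>i. sr (w i)) (\<lambda>i. sh (w i)) = W w" for w by (simp add: FE_def W_def)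
  define Gd where "Gd = {w. good d \<phi> \<epsilon>1 n w (dec (W w) (\<lambda>i. sz (w i)))}"
  have probG: "measure_pmf.prob ?P (- Gd) \<le> \<delta>"
    using measure_pmf.prob_compl[of Gd ?P] prob by (simp add: Compl_eq_Diff_UNIV Gd_def W_def)
  have D': "measure_pmf.expectation J (\<lambda>w. d (sr (fst w)) (\<phi> (snd w) (sz (fst w)))) \<le> D"
    using D by (simp add: joint_eq_map case_prod_beta)
  have D0: "0 \<le> measure_pmf.expectation J (\<lambda>w. d (sr (fst w)) (\<phi> (snd w) (sz (fst w))))"
    using d by simp
  have "real L \<le> 2 powr (real n * (R + \<epsilon>))"
    using R \<epsilon>1 by (intro order_trans[OF L(3)]) (auto intro!: mult_left_mono simp: \<epsilon>1_def)
  moreover have "measure_pmf.expectation ?P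
       (\<lambda>w. (1 / real n) * (\<Sum>i<n. d (sr (w i)) (FD (W w) (\<lambda>i. sz (w i)) i))) \<le> D + \<epsilon>"
  proof -
    have "measure_pmf.expectation ?P (\<lambda>w. (1 / real n) * (\<Sum>i<n. d (sr (w i)) (FD (W w) (\<lambda>i. sz (w i)) i)))
       \<le> measure_pmf.expectation ?P (\<lambda>w. (D + \<epsilon>1) + B * indicator (- Gd) w)"
    proof (rule expectation_mono_pmf[OF finP])
      fix w
      show "(1 / real n) * (\<Sum>i<n. d (sr (w i)) (FD (W w) (\<lambda>i. sz (w i)) i)) \<le> (D + \<epsilon>1) + B * indicator (- Gd) w"
      proof (cases "w \<in> Gd")
        case True
        then have "(\<Sum>i<n. d (sr (w i)) (FD (W w) (\<lambda>i. sz (w i)) i)) \<le> n * (measure_pmf.expectation J (\<lambda>w. d (sr (fst w)) (\<phi> (snd w) (sz (fst w)))) + \<epsilon>1)"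
          by (auto simp: Gd_def good_def FD_def)
        also have "\<dots> \<le> n * (D + \<epsilon>1)" using D' by (intro mult_left_mono) auto
        finally show ?thesis using True n by (simp add: divide_le_eq mult.commute)
      next
        case False
        have "(\<Sum>i<n. d (sr (w i)) (FD (W w) (\<lambda>i. sz (w i)) i)) \<le> (\<Sum>i<n. B)"
          using B by (intro sum_mono) auto
        then have "(1 / real n) * (\<Sum>i<n. d (sr (w i)) (FD (W w) (\<lambda>i. sz (w i)) i)) \<le> B"
          using n by (simp add: divide_le_eq mult.commute)
        then show ?thesis using False D0 D' \<epsilon>1 by simp
      qed
    qed
    also have "\<dots> = (D + \<epsilon>1) + B * measure_pmf.prob ?P (- Gd)"
      by (subst Bochner_Integration.integral_add) (auto intro: integrable_measure_pmf_finite[OF finP])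
    also have "\<dots> \<le> (D + \<epsilon>1) + B * \<delta>" using probG B0 by (intro add_left_mono mult_left_mono)
    also have "\<dots> \<le> D + \<epsilon>" using B\<delta> \<epsilon> by (simp add: \<epsilon>1_def)
    finally show ?thesis .
  qed
  moreover have "E - \<epsilon> \<le> (1 / real n) * cent ?P (\<lambda>w i. sh (w i)) (\<lambda>w. (W w, (\<lambda>i. sz (w i))))"
  proof -
    define H where "H = cent J (\<lambda>w. sr (fst w)) (\<lambda>w. (sh (fst w), sz (fst w), snd w))"
    have leak: "cent ?P (\<lambda>w i. sr (w i)) (\<lambda>w. ((\<lambda>i. sh (w i)), W w, (\<lambda>i. sz (w i))))
      \<le> 1 + n * (H + \<epsilon>1) + n * log 2 CARD('r) * \<delta>"
      using leakage_le[where n = n and d = d and \<phi> = \<phi> and dec = dec and W = W and \<delta> = \<delta> and \<epsilon> = \<epsilon>1, OF refl] prob \<epsilon>1 by (simp add: H_def W_def)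
    have src: "cent ?P (\<lambda>w. ((\<lambda>i. sr (w i)), (\<lambda>i. sh (w i)))) (\<lambda>w i. sz (w i)) = n * cent src sx sz"
      unfolding cent_src_n[symmetric] by (rule cent_cong) (auto simp: fun_eq_iff)
    have "log 2 L \<le> n * (rate + 3 * \<epsilon>1)"
      using L(1,3) by (simp add: log_le_iff)
    then have "n * cent src sx sz - n * (rate + 3 * \<epsilon>1) - (1 + n * (H + \<epsilon>1) + n * log 2 CARD('r) * \<delta>)
        \<le> cent ?P (\<lambda>w i. sh (w i)) (\<lambda>w. (W w, (\<lambda>i. sz (w i))))"
      using equivocation_lower[OF finP, of W "\<lambda>xr xh. enc (xr, xh)" "\<lambda>w i. sr (w i)" "\<lambda>w i. sh (w i)" L "\<lambda>w i. sz (w i)"]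
        L(2) leak src by (simp add: W_def)
    moreover have "n * (E - \<epsilon>) \<le> n * cent src sx sz - n * (rate + 3 * \<epsilon>1) - (1 + n * (H + \<epsilon>1) + n * log 2 CARD('r) * \<delta>)"
    proof -
      have 1: "ent (map_pmf (\<lambda>w. (sx (fst w), snd w, sz (fst w))) J) = ent (map_pmf (\<lambda>w. (sr (fst w), sh (fst w), sz (fst w), snd w)) J)"
        by (rule ent_map_inj') auto
      have 2: "ent (map_pmf (\<lambda>w. (sh (fst w), snd w, sz (fst w))) J) = ent (map_pmf (\<lambda>w. (sh (fst w), sz (fst w), snd w)) J)"
        by (rule ent_map_inj') auto
      \<comment> \<open>As \<open>rate\<close> is I(X;U|Z), the difference is H(X|U,Z) -
        H(X_r|X_h,U,Z): the losses of the code add up to precisely the single-letter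
        equivocation.\<close>
      have "cent src sx sz - rate - H = cent J (\<lambda>w. sh (fst w)) (\<lambda>w. (snd w, sz (fst w)))"
        by (simp add: rate_eq H_def cent_def 1 2)
      then have "E \<le> cent src sx sz - rate - H"
        using E by (simp add: joint_eq_map cent_map case_prod_beta)
      moreover have "1 \<le> n * \<epsilon>1" by (rule n\<epsilon>)
      moreover have "n * log 2 CARD('r) * \<delta> \<le> n * \<epsilon>1"
        using R\<delta> by (simp add: mult.assoc mult_left_mono)
      ultimately have "1 + n * log 2 CARD('r) * \<delta> \<le> n * \<epsilon>1 + n * \<epsilon>1"
        and le: "E - \<epsilon> \<le> cent src sx sz - rate - H - \<epsilon>" by linarith+
      moreover have "n * (E - \<epsilon>) \<le> n * (cent src sx sz - rate - H - \<epsilon>)"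
        using le by (rule mult_left_mono) simp
      moreover have "n * (cent src sx sz - rate - H - \<epsilon>) = n * cent src sx sz - n * rate - n * H - 8 * (n * \<epsilon>1)"
        by (simp add: \<epsilon>1_def algebra_simps)
      moreover have "n * (rate + 3 * \<epsilon>1) = n * rate + 3 * (n * \<epsilon>1)" "n * (H + \<epsilon>1) = n * H + n * \<epsilon>1"
        by (simp_all add: algebra_simps)
      moreover have "0 \<le> n * \<epsilon>1" using \<epsilon>1 by simp
      ultimately show ?thesis by linarith
    qed
    ultimately have "n * (E - \<epsilon>) \<le> cent ?P (\<lambda>w i. sh (w i)) (\<lambda>w. (W w, (\<lambda>i. sz (w i))))" by linarith
    then show ?thesis using n by (simp add: le_divide_eq mult.commute)
  qed
  moreover have "\<forall>xr xh. FE xr xh \<in> {1..L}" using L(2) by (simp add: FE_def)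
  ultimately have "code_ok src d R D E \<epsilon> n L FE FD"
    unfolding code_ok_def Let_def W by blast
  then show ?thesis using n L(1) by blast
qed

end

section \<open>Single-letter points as a convex hull\<close>

definition plog :: "real \<Rightarrow> real" where
  "plog t = - t * log 2 t"

lemma plog_0 [simp]: "plog 0 = 0" by (simp add: plog_def)

lemma plog_mult:
  assumes "0 \<le> c" "0 \<le> t"
  shows "plog (c * t) = c * plog t + t * plog c"
  using assms by (cases "c = 0 \<or> t = 0") (auto simp: plog_def log_mult algebra_simps)

text \<open>Continuity includes 0, so entropies remain continuous where posterior entries
  vanish.\<close>

lemma continuous_on_plog: "continuous_on {0..} plog"
  unfolding continuous_on_eq_continuous_within
proof
  fix t :: real assume t: "t \<in> {0..}"
  show "continuous (at t within {0..}) plog"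
  proof (cases "t = 0")
    case True
    have "((\<lambda>t::real. - t * log 2 t) \<longlongrightarrow> 0) (at_right 0)" by real_asymp
    then show ?thesis
      using True by (simp add: continuous_within at_within_Ici_at_right plog_def[abs_def])
  next
    case False
    then have "isCont plog t" using t unfolding plog_def[abs_def] by (intro continuous_intros) auto
    then show ?thesis by (rule continuous_at_imp_continuous_at_within)
  qed
qed

lemma sum_Times_swap: "(\<Sum>p\<in>A \<times> B. g p) = (\<Sum>y\<in>B. \<Sum>x\<in>A. g (x, y))"
  by (subst sum.swap) (simp add: sum.cartesian_product)

lemma ent_eq_sum_plog:
  assumes "finite A" "set_pmf p \<subseteq> A"
  shows "ent p = (\<Sum>x\<in>A. plog (pmf p x))"
proof -
  have "(\<Sum>x\<in>set_pmf p. plog (pmf p x)) = (\<Sum>x\<in>A. plog (pmf p x))"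
    using assms by (intro sum.mono_neutral_left) (auto simp: set_pmf_iff)
  then show ?thesis by (simp add: ent_def plog_def sum_negf)
qed

text \<open>By itself \<open>plog\<close> is not homogeneous: scaling by c adds t plog c. These
  terms cancel between the parts and their total, so conditional entropies scale linearly.\<close>

lemma plog_grouping_homogeneous:
  assumes "finite A" "0 \<le> c" "\<And>i. i \<in> A \<Longrightarrow> 0 \<le> t i"
  shows "(\<Sum>i\<in>A. plog (c * t i)) - plog (c * (\<Sum>i\<in>A. t i)) = c * ((\<Sum>i\<in>A. plog (t i)) - plog (\<Sum>i\<in>A. t i))"
proof -
  have "(\<Sum>i\<in>A. plog (c * t i)) = c * (\<Sum>i\<in>A. plog (t i)) + (\<Sum>i\<in>A. t i) * plog c"
    using assms by (simp add: plog_mult sum.distrib sum_distrib_left sum_distrib_right)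
  moreover have "plog (c * (\<Sum>i\<in>A. t i)) = c * plog (\<Sum>i\<in>A. t i) + (\<Sum>i\<in>A. t i) * plog c"
    using assms by (intro plog_mult sum_nonneg)
  ultimately show ?thesis by (simp add: algebra_simps)
qed

context
  fixes src :: "('r::finite \<times> 'h::finite \<times> 'z::finite) pmf"
    and d :: "'r \<Rightarrow> 'r \<Rightarrow> real"
begin

definition pub_priv_pmf :: "'r \<times> 'h \<Rightarrow> real" where
  "pub_priv_pmf x = pmf (map_pmf sx src) x"

text \<open>The conditional law p(z|x), equal to 0 where x has probability 0.\<close>

definition side_kernel :: "'r \<times> 'h \<Rightarrow> 'z \<Rightarrow> real" where
  "side_kernel x z = pmf src (fst x, snd x, z) / pub_priv_pmf x"

lemma side_kernel_nonneg: "0 \<le> side_kernel x z" by (simp add: side_kernel_def pub_priv_pmf_def)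

lemma marginal_times_side_kernel: "pub_priv_pmf (sx s) * side_kernel (sx s) (sz s) = pmf src s"
proof -
  have "pmf src s \<le> pub_priv_pmf (sx s)"
    unfolding pub_priv_pmf_def pmf_map by (rule order_trans[OF _ measure_pmf.finite_measure_mono[of "{s}"]])
      (auto simp: pmf.rep_eq)
  then show ?thesis by (auto simp: side_kernel_def pub_priv_pmf_def order.antisym)
qed

text \<open>A vector \<open>a\<close> stands for an unnormalised posterior p(x, u) with u fixed; the entropy terms are
  written with \<open>plog\<close> so that they are homogeneous in \<open>a\<close> and need no normalisation.\<close>

definition side_mass :: "real ^ ('r \<times> 'h) \<Rightarrow> 'z \<Rightarrow> real" where
  "side_mass a z = (\<Sum>x\<in>UNIV. a $ x * side_kernel x z)"

text \<open>The share of one value u in H(X|U,Z). The analogue for X_h, \<open>cent_priv\<close>,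
  first sums the public part out.\<close>

definition cent_all :: "real ^ ('r \<times> 'h) \<Rightarrow> real" where
  "cent_all a = (\<Sum>z\<in>UNIV. (\<Sum>x\<in>UNIV. plog (a $ x * side_kernel x z)) - plog (side_mass a z))"

definition cent_priv :: "real ^ ('r \<times> 'h) \<Rightarrow> real" where
  "cent_priv a = (\<Sum>z\<in>UNIV. (\<Sum>b\<in>UNIV. plog (\<Sum>r\<in>UNIV. a $ (r, b) * side_kernel (r, b) z)) - plog (side_mass a z))"

definition mean_dist :: "('z \<Rightarrow> 'r) \<Rightarrow> real ^ ('r \<times> 'h) \<Rightarrow> real" where
  "mean_dist f a = (\<Sum>z\<in>UNIV. \<Sum>x\<in>UNIV. a $ x * side_kernel x z * d (fst x) (f z))"

text \<open>The map \<open>f\<close> is the reconstruction used for one fixed u. Keeping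
  \<open>a\<close> as a component turns the requirement that posteriors average to the source law
  into an affine slice.\<close>

definition profile :: "('z \<Rightarrow> 'r) \<Rightarrow> real ^ ('r \<times> 'h) \<Rightarrow> (real ^ ('r \<times> 'h)) \<times> real \<times> real \<times> real" where
  "profile f a = (a, mean_dist f a, cent_priv a, cent_all a)"

lemma side_mass_alt: "side_mass a z = (\<Sum>b\<in>UNIV. \<Sum>r\<in>UNIV. a $ (r, b) * side_kernel (r, b) z)"
  unfolding side_mass_def by (subst sum.swap) (simp add: sum.cartesian_product case_prod_unfold)

lemma profile_scale:
  assumes c: "0 \<le> c" and a: "\<And>x. 0 \<le> a $ x"
  shows "profile f (c *\<^sub>R a) = c *\<^sub>R profile f a"
proof -
  have m: "side_mass (c *\<^sub>R a) z = c * side_mass a z" for z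
    by (simp add: side_mass_def sum_distrib_left mult.assoc)
  have "mean_dist f (c *\<^sub>R a) = c * mean_dist f a"
    by (simp add: mean_dist_def sum_distrib_left mult.assoc)
  moreover have "cent_all (c *\<^sub>R a) = c * cent_all a"
    unfolding cent_all_def m sum_distrib_left
  proof (intro sum.cong refl)
    fix z
    show "(\<Sum>x\<in>UNIV. plog ((c *\<^sub>R a) $ x * side_kernel x z)) - plog (c * side_mass a z)
      = c * ((\<Sum>x\<in>UNIV. plog (a $ x * side_kernel x z)) - plog (side_mass a z))"
      using plog_grouping_homogeneous[of UNIV c "\<lambda>x. a $ x * side_kernel x z"] c a side_kernel_nonneg
      by (simp add: side_mass_def mult.assoc)
  qed
  moreover have "cent_priv (c *\<^sub>R a) = c * cent_priv a"
    unfolding cent_priv_def m sum_distrib_left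
  proof (intro sum.cong refl)
    fix z
    show "(\<Sum>b\<in>UNIV. plog (\<Sum>r\<in>UNIV. (c *\<^sub>R a) $ (r, b) * side_kernel (r, b) z)) - plog (c * side_mass a z)
      = c * ((\<Sum>b\<in>UNIV. plog (\<Sum>r\<in>UNIV. a $ (r, b) * side_kernel (r, b) z)) - plog (side_mass a z))"
      using plog_grouping_homogeneous[of UNIV c "\<lambda>b. \<Sum>r\<in>UNIV. a $ (r, b) * side_kernel (r, b) z"] c a side_kernel_nonneg
      by (simp add: side_mass_alt mult.assoc sum_distrib_left sum_nonneg)
  qed
  ultimately show ?thesis by (simp add: profile_def)
qed

definition prob_vectors :: "(real ^ ('r \<times> 'h)) set" where
  "prob_vectors = {a. (\<forall>x. 0 \<le> a $ x) \<and> (\<Sum>x\<in>UNIV. a $ x) = 1}"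

definition profiles :: "((real ^ ('r \<times> 'h)) \<times> real \<times> real \<times> real) set" where
  "profiles = (\<Union>f. profile f ` prob_vectors)"

lemma compact_prob_vectors: "compact prob_vectors"
proof -
  have "closed prob_vectors"
    unfolding prob_vectors_def by (intro closed_Collect_conj closed_Collect_all closed_Collect_le closed_Collect_eq continuous_intros)
  moreover have "bounded prob_vectors"
    unfolding bounded_iff
  proof (intro exI ballI)
    fix a assume a: "a \<in> prob_vectors"
    have "norm a \<le> (\<Sum>x\<in>UNIV. \<bar>a $ x\<bar>)" by (rule norm_le_l1_cart)
    also have "\<dots> = (\<Sum>x\<in>UNIV. a $ x)"
      using a by (intro sum.cong refl) (simp add: prob_vectors_def del: split_paired_All)
    also have "\<dots> = 1" using a by (simp add: prob_vectors_def)
    finally show "norm a \<le> 1" .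
  qed
  ultimately show ?thesis by (simp add: compact_eq_bounded_closed)
qed

text \<open>Finite alphabets leave finitely many reconstructions \<open>f\<close>, each contributing
  a continuous image of the simplex.\<close>

lemma compact_profiles: "compact profiles"
  unfolding profiles_def
proof (rule compact_UN)
  fix f :: "'z \<Rightarrow> 'r"
  have plog: "continuous_on prob_vectors (\<lambda>a. plog (g a))"
    if "continuous_on prob_vectors g" "\<And>a. a \<in> prob_vectors \<Longrightarrow> 0 \<le> g a" for g :: "real ^ ('r \<times> 'h) \<Rightarrow> real"
    by (rule continuous_on_compose2[OF continuous_on_plog that(1)]) (use that(2) in auto)
  have "continuous_on prob_vectors (profile f)"
    unfolding profile_def cent_all_def cent_priv_def mean_dist_def side_mass_def
    by (intro continuous_intros plog) (auto simp: prob_vectors_def intro!: sum_nonneg mult_nonneg_nonneg side_kernel_nonneg)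
  then show "compact (profile f ` prob_vectors)" by (rule compact_continuous_image[OF _ compact_prob_vectors])
qed simp

definition weight :: "('r \<times> 'h \<Rightarrow> 'u pmf) \<Rightarrow> 'u \<Rightarrow> real ^ ('r \<times> 'h)" where
  "weight k u = (\<chi> x. pub_priv_pmf x * pmf (k x) u)"

lemma pmf_test_joint: "pmf (test_joint src k) (s, u) = weight k u $ sx s * side_kernel (sx s) (sz s)"
proof -
  have "pmf (test_joint src k) (s, u) = pmf src s * pmf (k (sx s)) u"
    unfolding test_joint_def by (rule pmf_bind_Pair)
  then show ?thesis by (simp add: weight_def marginal_times_side_kernel[symmetric] mult.commute mult.left_commute)
qed

text \<open>Distortion and conditional entropies given (U, Z) split over the values of U. With
  homogeneity, this makes every test channel a convex combination of profiles with weights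
  p(u).\<close>

lemma profile_sum:
  fixes k :: "'r \<times> 'h \<Rightarrow> 'u pmf"
  assumes fin: "finite U" and supp: "\<And>x. set_pmf (k x) \<subseteq> U"
  defines "J \<equiv> test_joint src k"
  shows "((\<chi> x. pub_priv_pmf x), measure_pmf.expectation J (\<lambda>w. d (sr (fst w)) (\<phi> (snd w) (sz (fst w)))),
      cent J (\<lambda>w. sh (fst w)) (\<lambda>w. (snd w, sz (fst w))), cent J (\<lambda>w. sx (fst w)) (\<lambda>w. (snd w, sz (fst w))))
    = (\<Sum>u\<in>U. profile (\<phi> u) (weight k u))"
proof -
  have suppJ: "set_pmf J \<subseteq> UNIV \<times> U" using supp by (auto simp: J_def test_joint_def)
  have pmfJ: "pmf J (s, u) = weight k u $ sx s * side_kernel (sx s) (sz s)" for s u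
    unfolding J_def by (rule pmf_test_joint)
  have split: "(\<Sum>s\<in>UNIV. g s) = (\<Sum>z\<in>UNIV. \<Sum>x\<in>UNIV. g (fst x, snd x, z))" for g :: "'r \<times> 'h \<times> 'z \<Rightarrow> real"
  proof -
    have "(\<Sum>z\<in>UNIV. \<Sum>x\<in>UNIV. g (fst x, snd x, z)) = (\<Sum>p\<in>UNIV \<times> UNIV. case p of (z, x) \<Rightarrow> g (fst x, snd x, z))"
      by (subst sum.cartesian_product) simp
    also have "\<dots> = (\<Sum>s\<in>UNIV. g s)"
      by (rule sum.reindex_bij_witness[of _ "\<lambda>s. (sz s, sx s)" "\<lambda>(z, x). (fst x, snd x, z)"]) auto
    finally show ?thesis by simp
  qed
  have 1: "(\<chi> x. pub_priv_pmf x) = (\<Sum>u\<in>U. weight k u)"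
  proof (rule vec_eq_iff[THEN iffD2], rule allI)
    fix x
    have "(\<Sum>u\<in>U. pmf (k x) u) = 1" by (rule sum_pmf_eq_1[OF fin supp])
    then show "(\<chi> x. pub_priv_pmf x) $ x = (\<Sum>u\<in>U. weight k u) $ x"
      by (simp add: weight_def sum_distrib_left[symmetric])
  qed
  have 2: "measure_pmf.expectation J (\<lambda>w. d (sr (fst w)) (\<phi> (snd w) (sz (fst w)))) = (\<Sum>u\<in>U. mean_dist (\<phi> u) (weight k u))"
  proof -
    have "measure_pmf.expectation J (\<lambda>w. d (sr (fst w)) (\<phi> (snd w) (sz (fst w))))
       = (\<Sum>w\<in>UNIV \<times> U. pmf J w * d (sr (fst w)) (\<phi> (snd w) (sz (fst w))))"
      using suppJ fin by (intro expectation_finite_pmf) auto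
    also have "\<dots> = (\<Sum>s\<in>UNIV. \<Sum>u\<in>U. pmf J (s, u) * d (sr s) (\<phi> u (sz s)))"
      by (subst sum.cartesian_product) (simp add: case_prod_unfold)
    also have "\<dots> = (\<Sum>u\<in>U. \<Sum>s\<in>UNIV. pmf J (s, u) * d (sr s) (\<phi> u (sz s)))" by (rule sum.swap)
    also have "\<dots> = (\<Sum>u\<in>U. mean_dist (\<phi> u) (weight k u))"
      by (simp only: split mean_dist_def pmfJ fst_conv snd_conv prod.collapse)
    finally show ?thesis .
  qed
  have UZ: "ent (map_pmf (\<lambda>w. (snd w, sz (fst w))) J) = (\<Sum>u\<in>U. \<Sum>z\<in>UNIV. plog (side_mass (weight k u) z))"
  proof -
    have "pmf (map_pmf (\<lambda>w. (snd w, sz (fst w))) J) (u, z) = side_mass (weight k u) z" for u z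
    proof -
      have "(\<lambda>w. (snd w, sz (fst w))) -` {(u, z)} = (\<lambda>x. ((fst x, snd x, z), u)) ` (UNIV :: ('r \<times> 'h) set)"
      proof (intro set_eqI iffI)
        fix w :: "('r \<times> 'h \<times> 'z) \<times> 'u" assume "w \<in> (\<lambda>w. (snd w, sz (fst w))) -` {(u, z)}"
        then show "w \<in> (\<lambda>x. ((fst x, snd x, z), u)) ` (UNIV :: ('r \<times> 'h) set)"
          by (intro image_eqI[of _ _ "sx (fst w)"]) (auto simp: prod_eq_iff)
      qed auto
      then show ?thesis
        by (simp add: pmf_map measure_measure_pmf_finite sum.reindex inj_on_def prod_eq_iff pmfJ side_mass_def)
    qed
    moreover have "ent (map_pmf (\<lambda>w. (snd w, sz (fst w))) J) = (\<Sum>(u,z)\<in>U \<times> UNIV. plog (pmf (map_pmf (\<lambda>w. (snd w, sz (fst w))) J) (u, z)))"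
      using suppJ fin by (subst ent_eq_sum_plog[of "U \<times> UNIV"]) auto
    ultimately show ?thesis by (simp add: sum.cartesian_product)
  qed
  have 3: "cent J (\<lambda>w. sh (fst w)) (\<lambda>w. (snd w, sz (fst w))) = (\<Sum>u\<in>U. cent_priv (weight k u))"
  proof -
    have "pmf (map_pmf (\<lambda>w. (sh (fst w), snd w, sz (fst w))) J) (b, u, z) = (\<Sum>r\<in>UNIV. weight k u $ (r, b) * side_kernel (r, b) z)" for b u z
    proof -
      have "(\<lambda>w. (sh (fst w), snd w, sz (fst w))) -` {(b, u, z)} = (\<lambda>r. ((r, b, z), u)) ` (UNIV :: 'r set)"
        by force
      then show ?thesis
        by (simp add: pmf_map measure_measure_pmf_finite sum.reindex inj_on_def pmfJ)
    qed
    moreover have "ent (map_pmf (\<lambda>w. (sh (fst w), snd w, sz (fst w))) J)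
      = (\<Sum>(u, z)\<in>U \<times> UNIV. \<Sum>b\<in>UNIV. plog (pmf (map_pmf (\<lambda>w. (sh (fst w), snd w, sz (fst w))) J) (b, u, z)))"
      using suppJ fin
      by (subst ent_eq_sum_plog[of "UNIV \<times> U \<times> UNIV"]) (auto simp: sum_Times_swap case_prod_unfold)
    ultimately have "ent (map_pmf (\<lambda>w. (sh (fst w), snd w, sz (fst w))) J)
      = (\<Sum>u\<in>U. \<Sum>z\<in>UNIV. \<Sum>b\<in>UNIV. plog (\<Sum>r\<in>UNIV. weight k u $ (r, b) * side_kernel (r, b) z))"
      by (simp add: sum.cartesian_product[symmetric])
    then show ?thesis by (simp add: cent_def UZ cent_priv_def sum_subtractf)
  qed
  have 4: "cent J (\<lambda>w. sx (fst w)) (\<lambda>w. (snd w, sz (fst w))) = (\<Sum>u\<in>U. cent_all (weight k u))"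
  proof -
    have "pmf (map_pmf (\<lambda>w. (sx (fst w), snd w, sz (fst w))) J) (x, u, z) = weight k u $ x * side_kernel x z" for x u z
    proof -
      have "(\<lambda>w. (sx (fst w), snd w, sz (fst w))) -` {(x, u, z)} = {((fst x, snd x, z), u)}"
        by force
      then show ?thesis by (simp add: pmf_map measure_pmf_single pmfJ)
    qed
    moreover have "ent (map_pmf (\<lambda>w. (sx (fst w), snd w, sz (fst w))) J)
      = (\<Sum>(u, z)\<in>U \<times> UNIV. \<Sum>x\<in>UNIV. plog (pmf (map_pmf (\<lambda>w. (sx (fst w), snd w, sz (fst w))) J) (x, u, z)))"
      using suppJ fin
      by (subst ent_eq_sum_plog[of "UNIV \<times> U \<times> UNIV"]) (auto simp: sum_Times_swap case_prod_unfold)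
    ultimately have "ent (map_pmf (\<lambda>w. (sx (fst w), snd w, sz (fst w))) J)
      = (\<Sum>u\<in>U. \<Sum>z\<in>UNIV. \<Sum>x\<in>UNIV. plog (weight k u $ x * side_kernel x z))"
      by (simp add: sum.cartesian_product[symmetric])
    then show ?thesis by (simp add: cent_def UZ cent_all_def sum_subtractf)
  qed
  show ?thesis unfolding 1 2 3 4 profile_def by (simp add: prod_eq_iff fst_sum snd_sum)
qed

lemma profile_in_hull:
  fixes k :: "'r \<times> 'h \<Rightarrow> 'u pmf"
  assumes fin: "finite U" and supp: "\<And>x. set_pmf (k x) \<subseteq> U"
  defines "J \<equiv> test_joint src k"
  shows "((\<chi> x. pub_priv_pmf x), measure_pmf.expectation J (\<lambda>w. d (sr (fst w)) (\<phi> (snd w) (sz (fst w)))),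
      cent J (\<lambda>w. sh (fst w)) (\<lambda>w. (snd w, sz (fst w))), cent J (\<lambda>w. sx (fst w)) (\<lambda>w. (snd w, sz (fst w))))
    \<in> convex hull profiles"
proof -
  define c where "c u = (\<Sum>x\<in>UNIV. weight k u $ x)" for u
  have w0: "0 \<le> weight k u $ x" for u x by (simp add: weight_def pub_priv_pmf_def)
  have c0: "0 \<le> c u" for u by (simp add: c_def w0 sum_nonneg)
  \<comment> \<open>A value u of probability 0 has no posterior. The uniform vector is an arbitrary
    point of the simplex, entering with coefficient 0.\<close>
  define nrm where "nrm u = (if c u = 0 then (\<chi> x. 1 / CARD('r \<times> 'h)) else (1 / c u) *\<^sub>R weight k u)" for u
  have nrm: "nrm u \<in> prob_vectors" for u
    using c0[of u] w0 by (auto simp: nrm_def prob_vectors_def c_def sum_divide_distrib[symmetric] simp del: card_prod)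
  have eq: "weight k u = c u *\<^sub>R nrm u" for u
  proof (cases "c u = 0")
    case True
    then have "weight k u = 0"
      using w0 by (auto simp: c_def vec_eq_iff sum_nonneg_eq_0_iff)
    then show ?thesis using True by simp
  qed (simp add: nrm_def)
  have "(\<Sum>u\<in>U. profile (\<phi> u) (weight k u)) = (\<Sum>u\<in>U. c u *\<^sub>R profile (\<phi> u) (nrm u))"
    unfolding eq
  proof (intro sum.cong refl profile_scale c0)
    show "0 \<le> nrm u $ x" for u x using nrm[of u] by (simp add: prob_vectors_def del: split_paired_All)
  qed
  also have "\<dots> \<in> convex hull profiles"
  proof (rule convex_sum[OF fin])
    have "(\<Sum>u\<in>U. c u) = (\<Sum>x\<in>UNIV. \<Sum>u\<in>U. weight k u $ x)"
      unfolding c_def by (rule sum.swap)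
    also have "\<dots> = (\<Sum>x\<in>UNIV. pub_priv_pmf x)"
      using sum_pmf_eq_1[OF fin supp] by (simp add: weight_def sum_distrib_left[symmetric])
    also have "\<dots> = 1" unfolding pub_priv_pmf_def by (rule sum_pmf_eq_1) auto
    finally show "(\<Sum>u\<in>U. c u) = 1" .
    show "profile (\<phi> u) (nrm u) \<in> convex hull profiles" for u
      using nrm by (intro hull_inc) (auto simp: profiles_def)
  qed (auto simp: c0)
  finally show ?thesis using profile_sum[OF fin supp, where \<phi> = \<phi>] by (simp add: J_def)
qed

text \<open>Reads a finite convex combination backwards: its points become the values of U, the
  coefficients p(u), the vectors p(x|u). The first component says that these average to p(x), so
  Bayes' rule defines the channel.\<close>

lemma hull_point_realized:
  assumes v: "((\<chi> x. pub_priv_pmf x), D, E, F) \<in> convex hull profiles"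
  shows "\<exists>Q \<phi>. aux_ok Q \<and> measure_pmf.expectation (test_joint src Q) (\<lambda>w. d (sr (fst w)) (\<phi> (snd w) (sz (fst w)))) = D
    \<and> cent (test_joint src Q) (\<lambda>w. sh (fst w)) (\<lambda>w. (snd w, sz (fst w))) = E
    \<and> cent (test_joint src Q) (\<lambda>w. sx (fst w)) (\<lambda>w. (snd w, sz (fst w))) = F"
proof -
  from v obtain S c where S: "finite S" "S \<subseteq> profiles" and c: "\<And>y. y \<in> S \<Longrightarrow> 0 \<le> c y" "sum c S = 1"
    and vS: "(\<Sum>y\<in>S. c y *\<^sub>R y) = ((\<chi> x. pub_priv_pmf x), D, E, F)"
    unfolding convex_hull_explicit by blast
  from S(2) have "\<forall>y\<in>S. \<exists>f a. a \<in> prob_vectors \<and> y = profile f a" unfolding profiles_def by blast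
  then obtain f a where fa: "\<And>y. y \<in> S \<Longrightarrow> a y \<in> prob_vectors \<and> y = profile (f y) (a y)" by metis
  \<comment> \<open>Auxiliary alphabets are sets of naturals, hence the numbering of the
    points.\<close>
  obtain e where e: "bij_betw e {..<card S} S"
    using ex_bij_betw_nat_finite[OF S(1)] by (auto simp: atLeast0LessThan)
  define m where "m = card S"
  have eS: "e u \<in> S" if "u < m" for u using e that by (auto simp: m_def bij_betw_def)
  define g where "g x u = (if u < m then c (e u) * a (e u) $ x else 0)" for x u
  have a0: "0 \<le> a y $ x" if "y \<in> S" for x y
    using fa[OF that] by (simp add: prob_vectors_def del: split_paired_All)
  have g0: "0 \<le> g x u" for x u using c a0 eS by (simp add: g_def)
  have v_sum: "(\<Sum>u<m. c (e u) *\<^sub>R profile (f (e u)) (a (e u))) = ((\<chi> x. pub_priv_pmf x), D, E, F)"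
  proof -
    have "(\<Sum>u<m. c (e u) *\<^sub>R profile (f (e u)) (a (e u))) = (\<Sum>u<m. c (e u) *\<^sub>R e u)"
      using fa eS by (intro sum.cong refl) (metis lessThan_iff)
    also have "\<dots> = (\<Sum>y\<in>S. c y *\<^sub>R y)" using sum.reindex_bij_betw[OF e] by (simp add: m_def)
    finally show ?thesis by (simp add: vS)
  qed
  have g_sum: "(\<Sum>u<m. g x u) = pub_priv_pmf x" for x
  proof -
    have "fst (\<Sum>u<m. c (e u) *\<^sub>R profile (f (e u)) (a (e u))) = (\<Sum>u<m. c (e u) *\<^sub>R a (e u))"
      by (simp add: fst_sum profile_def)
    then have "(\<Sum>u<m. c (e u) *\<^sub>R a (e u)) = (\<chi> x. pub_priv_pmf x)" by (simp add: v_sum)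
    then have "(\<Sum>u<m. c (e u) *\<^sub>R a (e u)) $ x = pub_priv_pmf x" by simp
    then show ?thesis by (simp add: g_def)
  qed
  \<comment> \<open>Bayes' rule is void at a null x. There any law within \<open>{..<m}\<close> will
    do, and 0 lies in it because the combination is nonempty.\<close>
  define Q where "Q x = (if pub_priv_pmf x = 0 then return_pmf 0 else embed_pmf (\<lambda>u. g x u / pub_priv_pmf x))" for x
  have pX0: "0 \<le> pub_priv_pmf x" for x by (simp add: pub_priv_pmf_def)
  have pmfQ: "pmf (Q x) u = g x u / pub_priv_pmf x" if "pub_priv_pmf x \<noteq> 0" for x u
  proof -
    have "(\<integral>\<^sup>+ u. ennreal (g x u / pub_priv_pmf x) \<partial>count_space UNIV) = (\<Sum>u<m. ennreal (g x u / pub_priv_pmf x))"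
      by (rule nn_integral_count_space') (auto simp: g_def)
    also have "\<dots> = ennreal (\<Sum>u<m. g x u / pub_priv_pmf x)"
      using g0 pX0 by (intro sum_ennreal) auto
    also have "\<dots> = 1" using that by (simp add: sum_divide_distrib[symmetric] g_sum)
    finally show ?thesis using that g0 pX0 by (simp add: Q_def pmf_embed_pmf)
  qed
  have m: "0 < m" using c(2) by (auto simp: m_def S(1) card_gt_0_iff)
  have suppQ: "set_pmf (Q x) \<subseteq> {..<m}" for x
  proof (cases "pub_priv_pmf x = 0")
    case True then show ?thesis using m by (simp add: Q_def)
  next
    case False
    show ?thesis
    proof
      fix u assume "u \<in> set_pmf (Q x)"
      then show "u \<in> {..<m}" using pmfQ[OF False, of u] by (auto simp: set_pmf_iff g_def split: if_splits)
    qed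
  qed
  have w: "weight Q u = c (e u) *\<^sub>R a (e u)" if "u < m" for u
  proof (rule vec_eq_iff[THEN iffD2], rule allI)
    fix x
    have "pub_priv_pmf x * pmf (Q x) u = g x u"
    proof (cases "pub_priv_pmf x = 0")
      case True
      then have "(\<Sum>u<m. g x u) = 0" by (simp add: g_sum)
      then have "g x u = 0" using g0 that by (subst (asm) sum_nonneg_eq_0_iff) auto
      then show ?thesis using True by simp
    qed (simp add: pmfQ)
    then show "weight Q u $ x = (c (e u) *\<^sub>R a (e u)) $ x" using that by (simp add: weight_def g_def)
  qed
  have "(\<Sum>u<m. profile (f (e u)) (weight Q u)) = ((\<chi> x. pub_priv_pmf x), D, E, F)"
    unfolding v_sum[symmetric]
  proof (intro sum.cong refl)
    fix u assume "u \<in> {..<m}"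
    then have u: "u < m" by simp
    show "profile (f (e u)) (weight Q u) = c (e u) *\<^sub>R profile (f (e u)) (a (e u))"
      unfolding w[OF u] using fa[OF eS[OF u]] c(1)[OF eS[OF u]] a0[OF eS[OF u]] by (intro profile_scale)
  qed
  with profile_sum[OF finite_lessThan suppQ, where \<phi> = "\<lambda>u. f (e u)"]
  have "((\<chi> x. pub_priv_pmf x), measure_pmf.expectation (test_joint src Q) (\<lambda>w. d (sr (fst w)) (f (e (snd w)) (sz (fst w)))),
      cent (test_joint src Q) (\<lambda>w. sh (fst w)) (\<lambda>w. (snd w, sz (fst w))),
      cent (test_joint src Q) (\<lambda>w. sx (fst w)) (\<lambda>w. (snd w, sz (fst w)))) = ((\<chi> x. pub_priv_pmf x), D, E, F)" by simp
  moreover have "aux_ok Q" unfolding aux_ok_def using suppQ by blast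
  ultimately show ?thesis by (intro exI[of _ Q] exI[of _ "\<lambda>u. f (e u)"]) simp
qed

end

section \<open>Converse\<close>

text \<open>Position i of the source together with the message and the other side information is a test
  channel applied to one letter: this is the Markov condition on U.\<close>

lemma src_n_eq_test_joint:
  fixes src :: "('r::finite \<times> 'h::finite \<times> 'z::finite) pmf"
    and FE :: "(nat \<Rightarrow> 'r) \<Rightarrow> (nat \<Rightarrow> 'h) \<Rightarrow> 'm" and i n :: nat
  assumes i: "i < n"
  defines "k \<equiv> \<lambda>x. map_pmf (\<lambda>f. (FE ((\<lambda>j. sr (f j))(i := fst x)) ((\<lambda>j. sh (f j))(i := snd x)), (\<lambda>j. sz (f j))(i := undefined)))
              (Pi_pmf ({..<n} - {i}) undefined (\<lambda>_. src))"
  shows "test_joint src k = map_pmf (\<lambda>w. (w i, FE (\<lambda>j. sr (w j)) (\<lambda>j. sh (w j)), (\<lambda>j. sz (w j))(i := undefined))) (src_n src n)"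
proof -
  \<comment> \<open>Splitting off letter i leaves independent remaining letters, so the message and
    the other side information depend on letter i only through (x_r, x_h).\<close>
  have "src_n src n = Pi_pmf (insert i ({..<n} - {i})) undefined (\<lambda>_. src)"
    using i by (simp add: src_n_def insert_absorb)
  also have "\<dots> = map_pmf (\<lambda>(y, f). f(i := y)) (pair_pmf src (Pi_pmf ({..<n} - {i}) undefined (\<lambda>_. src)))"
    by (rule Pi_pmf_insert) auto
  also have "\<dots> = src \<bind> (\<lambda>y. map_pmf (\<lambda>f. f(i := y)) (Pi_pmf ({..<n} - {i}) undefined (\<lambda>_. src)))"
    by (simp add: pair_pmf_def map_pmf_def bind_assoc_pmf bind_return_pmf)
  finally have P: "src_n src n = src \<bind> (\<lambda>y. map_pmf (\<lambda>f. f(i := y)) (Pi_pmf ({..<n} - {i}) undefined (\<lambda>_. src)))" .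
  have upd: "(\<lambda>j. sr ((f(i := y)) j)) = (\<lambda>j. sr (f j))(i := sr y)"
      "(\<lambda>j. sh ((f(i := y)) j)) = (\<lambda>j. sh (f j))(i := sh y)"
      "(\<lambda>j. sz ((f(i := y)) j)) = (\<lambda>j. sz (f j))(i := sz y)"
    for f and y :: "'r \<times> 'h \<times> 'z" by auto
  show ?thesis
    unfolding P test_joint_def k_def map_bind_pmf pmf.map_comp o_def upd by (simp del: fun_upd_apply add: fun_upd_same)
qed

text \<open>Each position gives a point of the hull, and by convexity so does their average; no
  time-sharing variable is introduced. The rate bound is recast as a lower bound on
  H(X|U,Z).\<close>

lemma converse_point:
  fixes src :: "('r::finite \<times> 'h::finite \<times> 'z::finite) pmf"
  assumes code: "code_ok src d R D E \<epsilon> n M FE FD" and n: "0 < n" and M: "0 < M"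
  obtains D' E' F' where "((\<chi> x. pub_priv_pmf src x), D', E', F') \<in> convex hull (profiles src d)"
    "D' \<le> D + \<epsilon>" "E - \<epsilon> \<le> E'" "cent src sx sz - (R + \<epsilon>) \<le> F'"
proof -
  let ?P = "src_n src n"
  define W where "W w = FE (\<lambda>j. sr (w j)) (\<lambda>j. sh (w j))" for w :: "nat \<Rightarrow> 'r \<times> 'h \<times> 'z"
  define Z where "Z w = (\<lambda>j. sz (w j))" for w :: "nat \<Rightarrow> 'r \<times> 'h \<times> 'z"
  define Y where "Y w = (W w, Z w)" for w
  have range: "W w \<in> {1..M}" for w
    using code unfolding code_ok_def Let_def W_def[abs_def] by auto
  have rate: "real M \<le> 2 powr (real n * (R + \<epsilon>))"
    and dist: "measure_pmf.expectation ?P (\<lambda>w. (1 / real n) * (\<Sum>i<n. d (sr (w i)) (FD (W w) (Z w) i))) \<le> D + \<epsilon>"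
    and equiv: "E - \<epsilon> \<le> (1 / real n) * cent ?P (\<lambda>w i. sh (w i)) Y"
    using code unfolding code_ok_def Let_def W_def[abs_def] Z_def[abs_def] Y_def[abs_def] by auto
  have finP: "finite (set_pmf ?P)" by (rule finite_set_src_n)
  have dflt: "w i = undefined" if "w \<in> set_pmf ?P" "n \<le> i" for w i
    using that by (auto simp: src_n_def set_Pi_pmf PiE_dflt_def)
  define Di where "Di i = measure_pmf.expectation ?P (\<lambda>w. d (sr (w i)) (FD (W w) (Z w) i))" for i
  define Ei where "Ei i = cent ?P (\<lambda>w. sh (w i)) Y" for i
  define Fi where "Fi i = cent ?P (\<lambda>w. sx (w i)) Y" for i
  have pt: "((\<chi> x. pub_priv_pmf src x), Di i, Ei i, Fi i) \<in> convex hull (profiles src d)" if i: "i < n" for i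
  proof -
    \<comment> \<open>Entry i of the side information is erased by \<open>undefined\<close>: kept in
      U, it would violate the Markov condition.\<close>
    define k where "k x = map_pmf (\<lambda>f. (FE ((\<lambda>j. sr (f j))(i := fst x)) ((\<lambda>j. sh (f j))(i := snd x)), (\<lambda>j. sz (f j))(i := undefined)))
              (Pi_pmf ({..<n} - {i}) undefined (\<lambda>_. src))" for x
    have J: "test_joint src k = map_pmf (\<lambda>w. (w i, W w, (Z w)(i := undefined))) ?P"
      using src_n_eq_test_joint[OF i, of src FE] unfolding k_def[abs_def] W_def[abs_def] Z_def[abs_def] .
    have fin: "finite (\<Union>x. set_pmf (k x))"
      by (auto simp: k_def intro!: finite_set_Pi_pmf)
    \<comment> \<open>The single-letter reconstruction puts z back at position i and thus reproduces
      the block decoder.\<close>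
    have "((\<chi> x. pub_priv_pmf src x), measure_pmf.expectation (test_joint src k) (\<lambda>w. d (sr (fst w)) ((\<lambda>u z. FD (fst u) ((snd u)(i := z)) i) (snd w) (sz (fst w)))),
      cent (test_joint src k) (\<lambda>w. sh (fst w)) (\<lambda>w. (snd w, sz (fst w))), cent (test_joint src k) (\<lambda>w. sx (fst w)) (\<lambda>w. (snd w, sz (fst w))))
    \<in> convex hull (profiles src d)"
      by (rule profile_in_hull[OF fin]) auto
    moreover have "measure_pmf.expectation (test_joint src k) (\<lambda>w. d (sr (fst w)) ((\<lambda>u z. FD (fst u) ((snd u)(i := z)) i) (snd w) (sz (fst w)))) = Di i"
    proof -
      have "(Z w)(i := sz (w i)) = Z w" for w by (auto simp: Z_def)
      then show ?thesis by (simp add: J Di_def)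
    qed
    \<comment> \<open>The pair (U_i, Z_i) and the full decoder input determine each other, so
      conditioning on either gives the same entropies.\<close>
    moreover have YZ: "((W w, (Z w)(i := undefined)), sz (w i)) = ((W w', (Z w')(i := undefined)), sz (w' i)) \<longleftrightarrow> Y w = Y w'" for w w'
      by (auto simp: Y_def Z_def fun_eq_iff)
    have "cent (test_joint src k) (\<lambda>w. sh (fst w)) (\<lambda>w. (snd w, sz (fst w))) = Ei i"
      unfolding J cent_map Ei_def fst_conv snd_conv by (rule cent_cong) (rule refl, rule YZ)
    moreover have "cent (test_joint src k) (\<lambda>w. sx (fst w)) (\<lambda>w. (snd w, sz (fst w))) = Fi i"
      unfolding J cent_map Fi_def fst_conv snd_conv by (rule cent_cong) (rule refl, rule YZ)
    ultimately show ?thesis by simp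
  qed
  have "(\<Sum>i<n. (1 / n) *\<^sub>R ((\<chi> x. pub_priv_pmf src x), Di i, Ei i, Fi i)) \<in> convex hull (profiles src d)"
    using pt n by (intro convex_sum) auto
  moreover have "(\<Sum>i<n. (1 / n) *\<^sub>R ((\<chi> x. pub_priv_pmf src x), Di i, Ei i, Fi i))
     = ((\<chi> x. pub_priv_pmf src x), (1/n) * (\<Sum>i<n. Di i), (1/n) * (\<Sum>i<n. Ei i), (1/n) * (\<Sum>i<n. Fi i))"
  proof -
    have "(\<Sum>i<n. (1 / real n) *\<^sub>R p) = p" for p :: "real ^ ('r \<times> 'h)"
      using n by (subst scaleR_left.sum[symmetric]) simp
    then show ?thesis by (simp add: prod_eq_iff fst_sum snd_sum sum_distrib_left del: sum_constant)
  qed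
  ultimately have "((\<chi> x. pub_priv_pmf src x), (1/n) * (\<Sum>i<n. Di i), (1/n) * (\<Sum>i<n. Ei i), (1/n) * (\<Sum>i<n. Fi i)) \<in> convex hull (profiles src d)"
    by simp
  moreover have "(1/n) * (\<Sum>i<n. Di i) \<le> D + \<epsilon>"
  proof -
    have "(\<Sum>i<n. Di i) = measure_pmf.expectation ?P (\<lambda>w. \<Sum>i<n. d (sr (w i)) (FD (W w) (Z w) i))"
      unfolding Di_def by (rule Bochner_Integration.integral_sum[symmetric]) (auto intro: integrable_measure_pmf_finite finP)
    then show ?thesis using dist by simp
  qed
  moreover have "E - \<epsilon> \<le> (1/n) * (\<Sum>i<n. Ei i)"
  proof -
    have "cent ?P (\<lambda>w i. sh (w i)) Y \<le> (\<Sum>i<n. Ei i)"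
      unfolding Ei_def by (rule cent_fun_le_sum[OF finP, where c = "sh (undefined :: 'r \<times> 'h \<times> 'z)"]) (simp add: dflt)
    then have "(1/n) * cent ?P (\<lambda>w i. sh (w i)) Y \<le> (1/n) * (\<Sum>i<n. Ei i)"
      by (intro mult_left_mono) auto
    then show ?thesis using equiv by linarith
  qed
  moreover have "cent src sx sz - (R + \<epsilon>) \<le> (1/n) * (\<Sum>i<n. Fi i)"
  proof -
    \<comment> \<open>The message is a function of the source word, so H(X^n|Z^n) = H(W|Z^n) +
      H(X^n|W,Z^n).\<close>
    have "n * cent src sx sz - log 2 M \<le> cent ?P (\<lambda>w i. sx (w i)) Y"
    proof -
      have "cent ?P W Z \<le> log 2 M"
        using cent_le_ent[OF finP, of W Z] ent_le_log_card[of "{1..M}" "map_pmf W ?P"] range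
        by force
      moreover have "ent (map_pmf (\<lambda>w. ((\<lambda>i. sx (w i)), Y w)) ?P) = ent (map_pmf (\<lambda>w. ((\<lambda>i. sx (w i)), (\<lambda>i. sz (w i)))) ?P)"
        by (rule ent_map_inj') (auto simp: Y_def W_def Z_def fun_eq_iff)
      ultimately show ?thesis
        unfolding cent_src_n[symmetric] by (simp add: cent_def Y_def[abs_def] Z_def[abs_def])
    qed
    moreover have "log 2 M \<le> n * (R + \<epsilon>)" using rate M by (simp add: log_le_iff)
    moreover have "cent ?P (\<lambda>w i. sx (w i)) Y \<le> (\<Sum>i<n. Fi i)"
      unfolding Fi_def by (rule cent_fun_le_sum[OF finP, where c = "sx (undefined :: 'r \<times> 'h \<times> 'z)"]) (simp add: dflt)
    ultimately have "n * (cent src sx sz - (R + \<epsilon>)) \<le> (\<Sum>i<n. Fi i)" by (simp add: algebra_simps)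
    then show ?thesis using n by (simp add: le_divide_eq mult.commute)
  qed
  ultimately show thesis by (rule that)
qed

text \<open>Each epsilon yields its own point. Minimising the violation over a compact set produces
  one point that satisfies all constraints exactly, and \<open>hull_point_realized\<close> gives its
  channel.\<close>

lemma converse:
  fixes src :: "('r::finite \<times> 'h::finite \<times> 'z::finite) pmf"
  assumes reg: "(R, D, E) \<in> region src d"
  obtains Q where "Q \<in> PDE src d D E" "test_channel.rate src Q \<le> R"
proof -
  define h0 where "h0 = cent src sx sz"
  let ?p = "(\<chi> x. pub_priv_pmf src x)"
  define C where "C = convex hull (profiles src d) \<inter> {v. fst v = ?p}"
  have "closed {v :: (real ^ ('r \<times> 'h)) \<times> real \<times> real \<times> real. fst v = ?p}"
    by (intro closed_Collect_eq continuous_intros)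
  then have C: "compact C"
    unfolding C_def by (intro compact_Int_closed compact_convex_hull compact_profiles)
  \<comment> \<open>The largest violation among distortion, equivocation and rate, the last
    expressed as H(X|U,Z) >= H(X|Z) - R.\<close>
  define g where "g v = max (fst (snd v) - D) (max (E - fst (snd (snd v))) (h0 - R - snd (snd (snd v))))"
    for v :: "(real ^ ('r \<times> 'h)) \<times> real \<times> real \<times> real"
  have g_cont: "continuous_on C g" unfolding g_def by (intro continuous_intros)
  have near: "\<exists>v\<in>C. g v \<le> \<epsilon>" if \<epsilon>: "0 < \<epsilon>" for \<epsilon>
  proof -
    from reg \<epsilon> obtain n M FE FD where n: "0 < n" and M: "0 < M" and code: "code_ok src d R D E \<epsilon> n M FE FD"
      unfolding region_def by blast
    obtain D' E' F' where "(?p, D', E', F') \<in> convex hull (profiles src d)"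
      "D' \<le> D + \<epsilon>" "E - \<epsilon> \<le> E'" "h0 - (R + \<epsilon>) \<le> F'"
      unfolding h0_def by (rule converse_point[OF code n M])
    then show ?thesis
      by (intro bexI[of _ "(?p, D', E', F')"]) (auto simp: C_def g_def)
  qed
  then have "C \<noteq> {}" using zero_less_one by blast
  from continuous_attains_inf[OF C this g_cont] obtain v where v: "v \<in> C" "\<And>y. y \<in> C \<Longrightarrow> g v \<le> g y" by blast
  have "g v \<le> 0"
  proof (rule field_le_epsilon)
    fix e :: real assume "0 < e"
    then obtain y where "y \<in> C" "g y \<le> e" using near by blast
    then show "g v \<le> 0 + e" using v(2)[of y] by simp
  qed
  obtain D' E' F' where v': "v = (?p, D', E', F')" using v(1) by (cases v) (auto simp: C_def)
  then have hull: "(?p, D', E', F') \<in> convex hull (profiles src d)" using v(1) by (simp add: C_def)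
  have le: "D' \<le> D" "E \<le> E'" "h0 - R \<le> F'" using \<open>g v \<le> 0\<close> by (auto simp: v' g_def)
  obtain Q \<phi> where Q: "aux_ok Q"
      "measure_pmf.expectation (test_joint src Q) (\<lambda>w. d (sr (fst w)) (\<phi> (snd w) (sz (fst w)))) = D'"
      "cent (test_joint src Q) (\<lambda>w. sh (fst w)) (\<lambda>w. (snd w, sz (fst w))) = E'"
      "cent (test_joint src Q) (\<lambda>w. sx (fst w)) (\<lambda>w. (snd w, sz (fst w))) = F'"
    using hull_point_realized[OF hull] by blast
  interpret test_channel src Q by unfold_locales (rule Q(1))
  have "Q \<in> PDE src d D E"
    using Q le by (auto simp: PDE_def joint_eq_map cent_map case_prod_beta intro!: exI[of _ \<phi>])
  moreover have "rate \<le> R" using le(3) by (simp add: rate_eq Q(4) h0_def)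
  ultimately show thesis by (rule that)
qed

text \<open>U = X_r attains the least distortion of all test channels, so the lower bound on E in
  \<open>PD\<close> affects neither the feasible distortions nor the supremum.\<close>

lemma reveal_public:
  fixes src :: "('r::finite \<times> 'h::finite \<times> 'z::finite) pmf"
  assumes d: "\<And>x y. 0 \<le> d x y" and Q: "Q \<in> PDE src d D E"
  shows "\<exists>Q0. aux_ok Q0 \<and> Q0 \<in> PDE src d D (cent src sh (\<lambda>s. (sr s, sz s))) \<and>
    cent (joint src Q0) (\<lambda>(xr, xh, z, u). xh) (\<lambda>(xr, xh, z, u). (u, z)) = cent src sh (\<lambda>s. (sr s, sz s))"
proof -
  obtain e :: "'r \<Rightarrow> nat" where e: "inj e"
    using finite_imp_inj_to_nat_seg[of "UNIV :: 'r set"] by auto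
  define Q0 where "Q0 x = return_pmf (e (fst x))" for x :: "'r \<times> 'h"
  define best where "best x = arg_min_on (d x) UNIV" for x
  have best: "d x (best x) \<le> d x y" for x y
    unfolding best_def by (rule arg_min_least) auto
  have J0: "test_joint src Q0 = map_pmf (\<lambda>s. (s, e (sr s))) src"
    by (simp add: test_joint_def Q0_def map_pmf_def bind_return_pmf)
  have ok: "aux_ok Q0" unfolding aux_ok_def by (intro exI[of _ "range e"]) (auto simp: Q0_def)
  have val: "cent (joint src Q0) (\<lambda>(xr, xh, z, u). xh) (\<lambda>(xr, xh, z, u). (u, z)) = cent src sh (\<lambda>s. (sr s, sz s))"
    unfolding joint_eq_map J0 cent_map case_prod_beta fst_conv snd_conv
    by (rule cent_cong) (auto simp: inj_eq[OF e])
  from Q obtain \<phi> where okQ: "aux_ok Q" and D: "measure_pmf.expectation (joint src Q) (\<lambda>(xr, xh, z, u). d xr (\<phi> u z)) \<le> D"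
    by (auto simp: PDE_def)
  interpret test_channel src Q by unfold_locales (rule okQ)
  have "measure_pmf.expectation (joint src Q0) (\<lambda>(xr, xh, z, u). d xr ((\<lambda>u z. best (inv e u)) u z))
      = measure_pmf.expectation src (\<lambda>s. d (sr s) (best (sr s)))"
    by (simp add: joint_eq_map J0 case_prod_beta inv_f_f[OF e])
  also have "\<dots> = measure_pmf.expectation (map_pmf (\<lambda>w. id (fst w)) J) (\<lambda>s. d (sr s) (best (sr s)))"
    by (subst map_fst_J) simp
  also have "\<dots> \<le> measure_pmf.expectation J (\<lambda>w. d (sr (fst w)) (\<phi> (snd w) (sz (fst w))))"
    unfolding integral_map_pmf id_apply by (intro expectation_mono_pmf best) simp
  also have "\<dots> \<le> D" using D by (simp add: joint_eq_map case_prod_beta)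
  finally have "Q0 \<in> PDE src d D (cent src sh (\<lambda>s. (sr s, sz s)))"
    using ok val unfolding PDE_def mem_Collect_eq
    by (intro conjI exI[of _ "\<lambda>u z. best (inv e u)"]) simp_all
  then show ?thesis using ok val by blast
qed

section \<open>From single-letter bounds to the regions\<close>

lemma code_ok_mono:
  assumes "code_ok src d R' D' E' \<epsilon>' n M FE FD"
    and "R' + \<epsilon>' \<le> R + \<epsilon>" "D' + \<epsilon>' \<le> D + \<epsilon>" "E - \<epsilon> \<le> E' - \<epsilon>'"
  shows "code_ok src d R D E \<epsilon> n M FE FD"
proof -
  have "2 powr (real n * (R' + \<epsilon>')) \<le> 2 powr (real n * (R + \<epsilon>))"
    using assms(2) by (simp add: mult_left_mono)
  note rate = order_trans[OF _ this]
  show ?thesis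
    using assms(1) unfolding code_ok_def Let_def
    by (elim conjE, intro conjI)
       (assumption, erule rate, erule order_trans[OF _ assms(3)], erule order_trans[OF assms(4)])
qed

text \<open>The sets \<open>PDE\<close> shrink as E grows, so the union is its member at the lowest
  E, which belongs to the interval since conditioning reduces entropy.\<close>

lemma PD_eq:
  fixes src :: "('r::finite \<times> 'h::finite \<times> 'z::finite) pmf"
  shows "PD src d D = PDE src d D (cent src sh (\<lambda>s. (sr s, sz s)))"
proof -
  have "cent src sh (\<lambda>s. (sr s, sz s)) \<le> cent src sh sz"
    by (rule cent_cond_le) simp
  moreover have sel: "(\<lambda>(xr :: 'r, xh :: 'h, z :: 'z). xh) = sh" "(\<lambda>(xr :: 'r, xh :: 'h, z :: 'z). (xr, z)) = (\<lambda>s. (sr s, sz s))"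
    "(\<lambda>(xr :: 'r, xh :: 'h, z :: 'z). z) = sz" by auto
  ultimately show ?thesis
    unfolding PD_def sel by (auto simp: PDE_def)
qed

text \<open>Below the threshold H(X_h|X_r,Z) the given channel may lie outside \<open>PD\<close>,
  and U = X_r takes its place; above it the channel itself qualifies.\<close>

lemma Gamma_info_ge:
  fixes src :: "('r::finite \<times> 'h::finite \<times> 'z::finite) pmf"
  assumes d: "\<And>x y. 0 \<le> d x y" and Q: "Q \<in> PDE src d D E"
  shows "ereal E \<le> Gamma_info src d D"
    and "ereal (cent src sh (\<lambda>s. (sr s, sz s))) \<le> Gamma_info src d D"
proof -
  from reveal_public[OF d Q] obtain Q0 where Q0: "Q0 \<in> PD src d D"
    and val: "cent (joint src Q0) (\<lambda>(xr, xh, z, u). xh) (\<lambda>(xr, xh, z, u). (u, z)) = cent src sh (\<lambda>s. (sr s, sz s))"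
    unfolding PD_eq by blast
  show *: "ereal (cent src sh (\<lambda>s. (sr s, sz s))) \<le> Gamma_info src d D"
    unfolding Gamma_info_def val[symmetric] by (rule SUP_upper[OF Q0])
  show "ereal E \<le> Gamma_info src d D"
  proof (cases "E \<le> cent src sh (\<lambda>s. (sr s, sz s))")
    case True
    then show ?thesis using * by (meson ereal_less_eq(3) order_trans)
  next
    case False
    have E: "ereal E \<le> ereal (cent (joint src Q) (\<lambda>(xr, xh, z, u). xh) (\<lambda>(xr, xh, z, u). (u, z)))"
      using Q by (simp add: PDE_def)
    have "Q \<in> PD src d D" using Q False unfolding PD_eq by (auto simp: PDE_def)
    then show ?thesis unfolding Gamma_info_def by (intro order_trans[OF E] SUP_upper)
  qed
qed

lemma Gamma_info_approx:
  assumes "ereal E \<le> Gamma_info src d D" and "0 < \<epsilon>"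
  obtains Q where "Q \<in> PDE src d D (E - \<epsilon>)"
proof -
  have "ereal (E - \<epsilon>) < Gamma_info src d D"
    using assms by (intro less_le_trans[OF _ assms(1)]) simp
  then obtain Q where "Q \<in> PD src d D"
    "ereal (E - \<epsilon>) < ereal (cent (joint src Q) (\<lambda>(xr, xh, z, u). xh) (\<lambda>(xr, xh, z, u). (u, z)))"
    unfolding Gamma_info_def less_SUP_iff by blast
  then have "Q \<in> PDE src d D (E - \<epsilon>)" by (auto simp: PD_def PDE_def)
  then show thesis by (rule that)
qed

lemma PDE_test_channel: "Q \<in> PDE src d D E \<Longrightarrow> test_channel Q"
  by unfold_locales (simp add: PDE_def)

lemma PDE_achievable:
  fixes src :: "('r::finite \<times> 'h::finite \<times> 'z::finite) pmf"
  assumes d: "\<And>x y. 0 \<le> d x y" and Q: "Q \<in> PDE src d D E" and R: "test_channel.rate src Q \<le> R" and \<epsilon>: "0 < \<epsilon>"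
  shows "\<exists>n>0. \<exists>M>0. \<exists>FE FD. code_ok src d R D E \<epsilon> n M FE FD"
proof -
  interpret test_channel src Q using Q by (rule PDE_test_channel)
  from Q obtain \<phi> where "measure_pmf.expectation (joint src Q) (\<lambda>(xr, xh, z, u). d xr (\<phi> u z)) \<le> D"
    by (auto simp: PDE_def)
  from achievability[OF d this _ R \<epsilon>] Q show ?thesis by (simp add: PDE_def)
qed

lemma Rate_info_eq: "Rate_info src d D E = (INF Q \<in> PDE src d D E. ereal (test_channel.rate src Q))"
  unfolding Rate_info_def
  by (intro INF_cong refl) (simp add: test_channel.rate_def[OF PDE_test_channel])

text \<open>Codes lead to a channel meeting all constraints exactly. Conversely, the infimum is
  approached within eps / 2, and the codes use up the other half.\<close>

lemma region_iff:
  fixes src :: "('r::finite \<times> 'h::finite \<times> 'z::finite) pmf"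
  assumes d: "\<And>x y. 0 \<le> d x y"
  shows "(R, D, E) \<in> region src d \<longleftrightarrow>
    D \<ge> 0 \<and> 0 \<le> E \<and> ereal E \<le> Gamma_info src d D \<and> ereal R \<ge> Rate_info src d D E"
proof (intro iffI conjI; (elim conjE)?)
  assume reg: "(R, D, E) \<in> region src d"
  then show "D \<ge> 0" "0 \<le> E" by (auto simp: region_def)
  from reg obtain Q where Q: "Q \<in> PDE src d D E" "test_channel.rate src Q \<le> R" by (rule converse)
  show "ereal E \<le> Gamma_info src d D" by (rule Gamma_info_ge(1)[OF d Q(1)])
  show "ereal R \<ge> Rate_info src d D E"
    unfolding Rate_info_eq using Q by (intro INF_lower2[of Q]) auto
next
  assume D: "D \<ge> 0" and E: "0 \<le> E" and R: "ereal R \<ge> Rate_info src d D E"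
  \<comment> \<open>Nonnegative rates are part of \<open>region\<close>; here this follows from
    I(X;U|Z) >= 0.\<close>
  have "0 \<le> Rate_info src d D E"
    unfolding Rate_info_eq by (intro INF_greatest) (simp add: test_channel.rate_nonneg[OF PDE_test_channel])
  then have "0 \<le> R" using R by (metis ereal_less_eq(5) order_trans)
  moreover have "\<exists>n>0. \<exists>M>0. \<exists>FE FD. code_ok src d R D E \<epsilon> n M FE FD" if \<epsilon>: "0 < \<epsilon>" for \<epsilon>
  proof -
    have "Rate_info src d D E < ereal (R + \<epsilon> / 2)" using R \<epsilon> by (intro le_less_trans[OF R]) simp
    then obtain Q where Q: "Q \<in> PDE src d D E" "test_channel.rate src Q < R + \<epsilon> / 2"
      unfolding Rate_info_eq INF_less_iff by auto
    have "\<exists>n>0. \<exists>M>0. \<exists>FE FD. code_ok src d (R + \<epsilon> / 2) D E (\<epsilon> / 2) n M FE FD"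
      by (rule PDE_achievable[OF d Q(1)]) (use Q(2) \<epsilon> in auto)
    then obtain n M FE FD where "0 < n" "0 < M" "code_ok src d (R + \<epsilon> / 2) D E (\<epsilon> / 2) n M FE FD"
      by blast
    moreover from this(3) have "code_ok src d R D E \<epsilon> n M FE FD"
      by (rule code_ok_mono) (use \<epsilon> in auto)
    ultimately show ?thesis by blast
  qed
  ultimately show "(R, D, E) \<in> region src d" using D E by (simp add: region_def)
qed

lemma region_DE_iff:
  fixes src :: "('r::finite \<times> 'h::finite \<times> 'z::finite) pmf"
  assumes d: "\<And>x y. 0 \<le> d x y"
  shows "(D, E) \<in> region_DE src d \<longleftrightarrow> D \<ge> 0 \<and> 0 \<le> E \<and> ereal E \<le> Gamma_info src d D"
proof
  assume "(D, E) \<in> region_DE src d"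
  then show "D \<ge> 0 \<and> 0 \<le> E \<and> ereal E \<le> Gamma_info src d D"
    by (auto simp: region_DE_def region_iff[OF d])
next
  assume DE: "D \<ge> 0 \<and> 0 \<le> E \<and> ereal E \<le> Gamma_info src d D"
  \<comment> \<open>The channels nearly attaining the supremum vary with epsilon, so one rate must
    serve them all: I(X;U|Z) <= H(X|Z).\<close>
  define R where "R = cent src sx sz"
  have R: "0 \<le> R" unfolding R_def by (rule cent_nonneg) simp
  have rate: "test_channel.rate src Q \<le> R" if "Q \<in> PDE src d D E'" for Q E'
  proof -
    interpret test_channel src Q using that by (rule PDE_test_channel)
    show ?thesis unfolding rate_eq R_def using cent_nonneg[OF finite_J] by simp
  qed
  have "\<exists>n>0. \<exists>M>0. \<exists>FE FD. code_ok src d R D E \<epsilon> n M FE FD" if \<epsilon>: "0 < \<epsilon>" for \<epsilon>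
  proof -
    obtain Q where Q: "Q \<in> PDE src d D (E - \<epsilon> / 2)"
      using Gamma_info_approx[of E src d D "\<epsilon> / 2"] DE \<epsilon> by auto
    have "\<exists>n>0. \<exists>M>0. \<exists>FE FD. code_ok src d R D (E - \<epsilon> / 2) (\<epsilon> / 2) n M FE FD"
      by (rule PDE_achievable[OF d Q rate[OF Q]]) (use \<epsilon> in simp)
    then obtain n M FE FD where "0 < n" "0 < M" "code_ok src d R D (E - \<epsilon> / 2) (\<epsilon> / 2) n M FE FD"
      by blast
    moreover from this(3) have "code_ok src d R D E \<epsilon> n M FE FD"
      by (rule code_ok_mono) (use \<epsilon> in auto)
    ultimately show ?thesis by blast
  qed
  then have "(R, D, E) \<in> region src d" using DE R by (simp add: region_def)
  then show "(D, E) \<in> region_DE src d" unfolding region_DE_def by (rule image_eqI[rotated]) simp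
qed

lemma Sup_ereal_lower: "0 \<le> g \<Longrightarrow> Sup {ereal E | E. 0 \<le> E \<and> ereal E \<le> g} = g"
proof (rule antisym)
  assume g: "0 \<le> g"
  show "g \<le> Sup {ereal E | E. 0 \<le> E \<and> ereal E \<le> g}"
  proof (rule ccontr, unfold not_le)
    assume "Sup {ereal E | E. 0 \<le> E \<and> ereal E \<le> g} < g"
    then obtain r where r: "Sup {ereal E | E. 0 \<le> E \<and> ereal E \<le> g} < ereal r" "ereal r < g"
      using ereal_dense2 by blast
    \<comment> \<open>Truncation at 0 makes the intermediate value an admissible
      equivocation.\<close>
    have "ereal (max r 0) \<le> Sup {ereal E | E. 0 \<le> E \<and> ereal E \<le> g}"
      using r(2) g by (intro Sup_upper) (auto simp: max_def zero_ereal_def)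
    moreover have "ereal r \<le> ereal (max r 0)" by simp
    ultimately show False using r(1) by (meson leD order_trans)
  qed
qed (blast intro: Sup_least)

lemma Inf_ereal_upper: "Inf {ereal R | R. g \<le> ereal R} = g"
proof (rule antisym)
  show "Inf {ereal R | R. g \<le> ereal R} \<le> g"
  proof (rule ccontr, unfold not_le)
    assume "g < Inf {ereal R | R. g \<le> ereal R}"
    then obtain r where "g < ereal r" "ereal r < Inf {ereal R | R. g \<le> ereal R}"
      using ereal_dense2 by blast
    moreover from this(1) have "Inf {ereal R | R. g \<le> ereal R} \<le> ereal r" by (intro Inf_lower) auto
    ultimately show False by simp
  qed
qed (blast intro: Inf_greatest)

theorem theorem2:
  fixes src :: "('r::finite \<times> 'h::finite \<times> 'z::finite) pmf"
    and d :: "'r \<Rightarrow> 'r \<Rightarrow> real"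
  assumes d_nonneg: "\<forall>x y. d x y \<ge> 0"
  shows "(\<forall>D. Gamma_op src d D = Gamma_info src d D)
    \<and> (\<forall>D E. (D, E) \<in> region_DE src d \<longrightarrow> Rate_op src d D E = Rate_info src d D E)
    \<and> region_DE src d = {(D, E). D \<ge> 0 \<and> 0 \<le> E \<and> ereal E \<le> Gamma_info src d D}
    \<and> region src d = {(R, D, E). D \<ge> 0 \<and> 0 \<le> E \<and> ereal E \<le> Gamma_info src d D
                                \<and> ereal R \<ge> Rate_info src d D E}"
proof (intro conjI allI impI)
  have d: "0 \<le> d x y" for x y using d_nonneg by simp
  show "Gamma_op src d D = Gamma_info src d D" for D
  \<comment> \<open>If no channel meets the distortion level, both sides are suprema of empty
    sets.\<close>
  proof (cases "PD src d D = {}")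
    case True
    then have "Gamma_info src d D = - \<infinity>" by (simp add: Gamma_info_def bot_ereal_def)
    then show ?thesis by (simp add: Gamma_op_def region_DE_iff[OF d] bot_ereal_def)
  next
    case False
    then obtain Q where Q: "Q \<in> PDE src d D (cent src sh (\<lambda>s. (sr s, sz s)))" by (auto simp: PD_eq)
    have "0 \<le> ereal (cent src sh (\<lambda>s. (sr s, sz s)))" by (simp add: cent_nonneg)
    also have "\<dots> \<le> Gamma_info src d D" by (rule Gamma_info_ge(2)[OF d Q])
    finally have G: "0 \<le> Gamma_info src d D" .
    \<comment> \<open>The condition D >= 0 of \<open>region_DE\<close> follows because D bounds the
      mean of a nonnegative distortion.\<close>
    from Q obtain \<phi> where "measure_pmf.expectation (joint src Q) (\<lambda>(xr, xh, z, u). d xr (\<phi> u z)) \<le> D"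
      by (auto simp: PDE_def)
    moreover have "0 \<le> measure_pmf.expectation (joint src Q) (\<lambda>(xr, xh, z, u). d xr (\<phi> u z))"
      using d by (intro integral_nonneg_AE) auto
    ultimately have "0 \<le> D" by linarith
    then show ?thesis
      using Sup_ereal_lower[OF G] by (simp add: Gamma_op_def region_DE_iff[OF d])
  qed
  show "Rate_op src d D E = Rate_info src d D E" if "(D, E) \<in> region_DE src d" for D E
    using that Inf_ereal_upper[of "Rate_info src d D E"]
    by (simp add: Rate_op_def region_iff[OF d] region_DE_iff[OF d])
  show "region_DE src d = {(D, E). D \<ge> 0 \<and> 0 \<le> E \<and> ereal E \<le> Gamma_info src d D}"
    by (auto simp: region_DE_iff[OF d])
  show "region src d = {(R, D, E). D \<ge> 0 \<and> 0 \<le> E \<and> ereal E \<le> Gamma_info src d D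
                                \<and> ereal R \<ge> Rate_info src d D E}"
    by (auto simp: region_iff[OF d])
qed

end
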